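(* Let $(X,\mathcal{B},\mu,T)$ be an ergodic, aperiodic, invertible probability measure preserving transformation of a standard probability space. Let $A$ be a finite set, $(d_n)_{n\ge 1}$ a sequence of positive integers, and $\mathbb{X}=\{X_{n,m}\}_{n\in\mathbb{N},\,0\le m\le d_n-1}$ an $A$-valued triangular array. Then there exists a sequence of measurable functions $f_n:X\to A$, $n\in\mathbb{N}$, such that the families $\{f_n\circ T^m\}_{n\in\mathbb{N},\,0\le m\le d_n-1}$ and $\mathbb{X}$ have the same (joint) distribution.
   Context: An $A$-valued triangular array $\{X_{n,m}\}_{n\in\mathbb{N},\,0\le m\le d_n-1}$ is a family of $A$-valued random variables on a probability space $(\Omega,\mathcal{F},\mathbb{P})$ such that for every $n$ the variables $X_{n,0},\dots,X_{n,d_n-1}$ are identically distributed, and the whole family is independent. Aperiodic means that $\mu$-almost every point is not periodic for $T$. *)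

theory Defs
  imports "HOL-Probability.Probability"
begin

definition standard_borel :: "'x measure \<Rightarrow> bool" where
  "standard_borel M \<longleftrightarrow>
     (\<exists>S. completely_metrizable_space S \<and> second_countable S \<and>
          space M = topspace S \<and> sets M = sigma_sets (topspace S) {U. openin S U})"

text \<open>
  The literature uses the name both for a Borel probability measure on a standard Borel space
  and for the completion of one (a Lebesgue space); both are admitted.
\<close>

definition standard_prob_space :: "'x measure \<Rightarrow> bool" where
  "standard_prob_space M \<longleftrightarrow>
     prob_space M \<and> (\<exists>N. standard_borel N \<and> (M = N \<or> M = completion N))"

definition measure_preserving :: "'x measure \<Rightarrow> ('x \<Rightarrow> 'x) \<Rightarrow> bool" where
  "measure_preserving M T \<longleftrightarrow> T \<in> measurable M M \<and> distr M M T = M"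

definition invertible_on :: "'x measure \<Rightarrow> ('x \<Rightarrow> 'x) \<Rightarrow> bool" where
  "invertible_on M T \<longleftrightarrow>
     bij_betw T (space M) (space M) \<and> the_inv_into (space M) T \<in> measurable M M"

definition ergodic :: "'x measure \<Rightarrow> ('x \<Rightarrow> 'x) \<Rightarrow> bool" where
  "ergodic M T \<longleftrightarrow>
     (\<forall>B\<in>sets M. T -` B \<inter> space M = B \<longrightarrow> measure M B = 0 \<or> measure M B = 1)"

definition aperiodic :: "'x measure \<Rightarrow> ('x \<Rightarrow> 'x) \<Rightarrow> bool" where
  "aperiodic M T \<longleftrightarrow> (AE x in M. \<not> (\<exists>k\<ge>1. (T ^^ k) x = x))"

definition array_index :: "(nat \<Rightarrow> nat) \<Rightarrow> (nat \<times> nat) set" where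
  "array_index d = {(n, m). 1 \<le> n \<and> m < d n}"

definition triangular_array ::
  "'w measure \<Rightarrow> 'a set \<Rightarrow> (nat \<Rightarrow> nat) \<Rightarrow> (nat \<Rightarrow> nat \<Rightarrow> 'w \<Rightarrow> 'a) \<Rightarrow> bool" where
  "triangular_array P A d X \<longleftrightarrow>
     prob_space P \<and>
     (\<forall>(n, m)\<in>array_index d. X n m \<in> measurable P (count_space A)) \<and>
     (\<forall>n\<ge>1. \<forall>m<d n. \<forall>m'<d n.
        distr P (count_space A) (X n m) = distr P (count_space A) (X n m')) \<and>
     prob_space.indep_vars P (\<lambda>_. count_space A) (\<lambda>(n, m). X n m) (array_index d)"

definition joint_distr ::
  "'w measure \<Rightarrow> 'a set \<Rightarrow> (nat \<Rightarrow> nat) \<Rightarrow> (nat \<Rightarrow> nat \<Rightarrow> 'w \<Rightarrow> 'a) \<Rightarrow> (nat \<times> nat \<Rightarrow> 'a) measure" where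
  "joint_distr P A d X =
     distr P (PiM (array_index d) (\<lambda>_. count_space A))
       (\<lambda>\<omega>. restrict (\<lambda>(n, m). X n m \<omega>) (array_index d))"

end

theory Submission
  imports Defs
begin

text \<open>
  The rows are painted one after the other, each with a finite independence requirement relative
  to the partition \<open>Q\<close> generated by the windows of the earlier rows. For one row, fix a letter
  \<open>a\<close> and a decreasing chain of sets \<open>E N\<close> of positive measure whose return times are at
  least \<open>N\<close>; by ergodicity, each \<open>E N\<close> cuts almost every orbit into columns. Only paintings that
  show \<open>a\<close> during the first \<open>d\<close> steps after a visit to some \<open>E N\<close> are admitted, so two paintings
  can be mixed column by column without interaction. Since \<open>M\<close> has no atoms, the set of columns
  painted by the first of them can be chosen independent of everything visible on the column, so
  the joint laws of \<open>Q\<close> and the window form a convex set. It remains to see that no linear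
  functional separates the desired law from this set unless it is constant on it. If a painting \<open>f\<close>
  has a negative value, then a painting with positive value is found greedily along each column, in
  blocks of length \<open>L\<close>: the next block has average value zero under the i.i.d. law, in which the
  block of \<open>f\<close> has weight at least \<open>s ^ L\<close>, so some block gains \<open>s ^ L\<close> times the loss of \<open>f\<close>, up to
  an error that is independent of \<open>L\<close>. The error per column is negligible once \<open>N\<close> is large.
\<close>

subsection \<open>Linear functionals on convex sets\<close>

text \<open>The law has to be met exactly, although the windows seen just after a visit are
  prescribed rather than random. Improving the law step by step would need a limit of paintings, and
  there is no reason for the set of attainable laws to be closed. Convexity in finite dimension
  removes the obstacle: a point that cannot be properly separated from a convex set lies in its
  relative interior, hence in the set. So it suffices to treat one functional at a time, which is a
  question about averages. Zero average under the i.i.d. law does not by itself produce a positive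
  value, since the prefixes may cost something. The loss of \<open>f\<close> supplies a gain that
  grows with the height of a column: per level about \<open>s ^ L\<close> times the loss of
  \<open>f\<close> reduced by \<open>4 * d * C / L\<close>. This dictates the order of the
  constants: first \<open>L\<close>, so that half of the loss survives, then \<open>N\<close>, so
  that the boundary terms of size \<open>7 * L * C\<close>, one for each column, are
  outweighed.\<close>

lemma convex_common_zero:
  fixes S :: "('i \<Rightarrow> real) set"
  assumes "finite I" "S \<noteq> {}"
    and "\<And>x y t. x \<in> S \<Longrightarrow> y \<in> S \<Longrightarrow> 0 < t \<Longrightarrow> t < 1 \<Longrightarrow> (\<lambda>i. t * x i + (1 - t) * y i) \<in> S"
    and "\<And>c. (\<And>x. x \<in> S \<Longrightarrow> (\<Sum>i\<in>I. c i * x i) \<le> 0) \<Longrightarrow> (\<And>x. x \<in> S \<Longrightarrow> (\<Sum>i\<in>I. c i * x i) = 0)"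
  shows "\<exists>x\<in>S. \<forall>i\<in>I. x i = 0"
  using assms
proof (induction I arbitrary: S rule: finite_induct)
  case empty
  then show ?case by auto
next
  case (insert k I)
  note conv = insert.prems(2) and sep = insert.prems(3)
  have upd: "(\<Sum>i\<in>insert k I. (c(k := e)) i * x i) = e * x k + (\<Sum>i\<in>I. c i * x i)" for c e and x :: "'i \<Rightarrow> real"
    using insert.hyps by (auto intro!: sum.cong)
  have unit: "(\<Sum>i\<in>insert k I. ((\<lambda>_. 0)(k := e)) i * x i) = e * x k" for e and x :: "'i \<Rightarrow> real"
    by (subst upd) simp
  show ?case
  proof (cases "\<forall>x\<in>S. x k = 0")
    case True
    have "\<exists>x\<in>S. \<forall>i\<in>I. x i = 0"
    proof (rule insert.IH[OF insert.prems(1) conv])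
      fix c x assume "\<And>x. x \<in> S \<Longrightarrow> (\<Sum>i\<in>I. c i * x i) \<le> 0" "x \<in> S"
      then show "(\<Sum>i\<in>I. c i * x i) = 0"
        using sep[of "c(k := 0)" x] unfolding upd by simp
    qed auto
    with True show ?thesis by auto
  next
    case False
    have both: "\<exists>x\<in>S. e * x k > 0" if "e \<noteq> 0" for e
    proof (rule ccontr)
      assume "\<not> ?thesis"
      then have "e * x k \<le> 0" if "x \<in> S" for x using that by force
      then have "e * x k = 0" if "x \<in> S" for x
        using sep[of "(\<lambda>_. 0)(k := e)" x] that unfolding unit by auto
      with False \<open>e \<noteq> 0\<close> show False by auto
    qed
    obtain a b where a: "a \<in> S" "a k > 0" and b: "b \<in> S" "b k < 0"
      using both[of 1] both[of "-1"] by auto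
    define S' where "S' = {x\<in>S. x k = 0}"
    have mix: "\<exists>z\<in>S'. \<exists>m>0. \<forall>i. m * z i = x i / x k + y i / (- y k)"
      if x: "x \<in> S" "x k > 0" and y: "y \<in> S" "y k < 0" for x y
    proof -
      \<comment> \<open>The segment from \<open>x\<close> to \<open>y\<close> crosses the hyperplane
        at weights proportional to \<open>1 / x k\<close> and \<open>1 / (- y k)\<close>, and
        \<open>m\<close> normalises them. Keeping \<open>m\<close> as a factor leaves a sum of a
        term in \<open>x\<close> and a term in \<open>y\<close>, which is what a comparison of
        slopes needs.\<close>
      define m where "m = 1 / x k + 1 / (- y k)"
      define t where "t = (1 / x k) / m"
      have "0 < 1 / x k" "0 < 1 / (- y k)" using x y by simp_all
      then have m: "m > 0" unfolding m_def by (rule add_pos_pos)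
      have mt: "m * t = 1 / x k" using m by (simp add: t_def)
      have "m * (1 - t) = m - m * t" by (simp add: algebra_simps)
      then have mt': "m * (1 - t) = 1 / (- y k)" unfolding mt by (simp add: m_def)
      have t: "0 < t" using m x by (simp add: t_def)
      have "0 < m * (1 - t)" unfolding mt' using y by simp
      then have t': "t < 1" using m by (simp add: zero_less_mult_iff)
      let ?z = "\<lambda>i. t * x i + (1 - t) * y i"
      have eq: "m * ?z i = x i / x k + y i / (- y k)" for i
      proof -
        have "m * ?z i = (m * t) * x i + (m * (1 - t)) * y i" by (simp add: algebra_simps)
        then show ?thesis unfolding mt mt' by simp
      qed
      have "m * ?z k = 0" unfolding eq using x y by simp
      with m have "?z k = 0" by (metis mult_eq_0_iff less_irrefl)
      then have "?z \<in> S'" using conv[OF x(1) y(1) t t'] by (simp add: S'_def)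
      then show ?thesis by (intro bexI[of _ ?z] exI[of _ m]) (simp_all only: m eq simp_thms)
    qed
    have ne: "S' \<noteq> {}" using mix[OF a b] by auto
    have "\<exists>x\<in>S'. \<forall>i\<in>I. x i = 0"
    proof (rule insert.IH[OF ne])
      fix x y t assume "x \<in> S'" "y \<in> S'" "0 < t" "t < (1::real)"
      then show "(\<lambda>i. t * x i + (1 - t) * y i) \<in> S'" using conv[of x y t] by (auto simp: S'_def)
    next
      fix c w assume le: "\<And>x. x \<in> S' \<Longrightarrow> (\<Sum>i\<in>I. c i * x i) \<le> 0" and w: "w \<in> S'"
      define F where "F x = (\<Sum>i\<in>I. c i * x i)" for x :: "'i \<Rightarrow> real"
      have key: "F x / x k \<le> F y / y k" if x: "x \<in> S" "x k > 0" and y: "y \<in> S" "y k < 0" for x y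
      proof -
        obtain z m where z: "z \<in> S'" "m > 0" and eq: "\<And>i. m * z i = x i / x k + y i / (- y k)"
          using mix[OF x y] by auto
        have "m * F z = (\<Sum>i\<in>I. c i * (m * z i))"
          by (simp add: F_def sum_distrib_left algebra_simps)
        also have "\<dots> = F x / x k + F y / (- y k)"
          unfolding eq F_def by (simp add: sum_divide_distrib sum.distrib[symmetric] algebra_simps)
        finally have "F x / x k + F y / (- y k) \<le> 0"
          using le[OF z(1)] z(2) unfolding F_def[symmetric] by (metis mult_nonneg_nonpos less_imp_le)
        then show ?thesis by simp
      qed
      \<comment> \<open>By \<open>key\<close> the slopes on both sides of the hyperplane \<open>x k = 0\<close> are separated by some \<open>e\<close>.\<close>
      let ?P = "(\<lambda>x. F x / x k) ` {x\<in>S. x k > 0}"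
      define e where "e = Sup ?P"
      have bdd: "bdd_above ?P" using key b by (auto intro!: bdd_aboveI)
      have up: "F x / x k \<le> e" if "x \<in> S" "x k > 0" for x
        unfolding e_def using bdd that by (intro cSup_upper) auto
      have lo: "e \<le> F y / y k" if "y \<in> S" "y k < 0" for y
        unfolding e_def using a key that by (intro cSup_least) auto
      have "F x + (- e) * x k \<le> 0" if "x \<in> S" for x
      proof -
        consider "x k > 0" | "x k < 0" | "x k = 0" by linarith
        then show ?thesis
        proof cases
          case 1 then show ?thesis using up[OF that] by (simp add: field_simps)
        next
          case 2 then show ?thesis using lo[OF that] by (simp add: field_simps)
        next
          case 3 then show ?thesis using le[of x] that by (simp add: S'_def F_def)
        qed
      qed
      then have "F w + (- e) * w k = 0"
        using sep[of "c(k := - e)" w] w unfolding upd F_def S'_def by (auto simp: add.commute)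
      then show "(\<Sum>i\<in>I. c i * w i) = 0" using w by (simp add: S'_def F_def)
    qed
    then show ?thesis by (auto simp: S'_def)
  qed
qed

subsection \<open>Greedy choice of words\<close>

text \<open>Strict positivity gives every word of length \<open>n\<close> weight at least
  \<open>s ^ n\<close> for some \<open>s > 0\<close>. Letters of probability zero are removed before
  this locale is used.\<close>

locale letters =
  fixes A :: "'b set" and p :: "'b \<Rightarrow> real"
  assumes finite_A: "finite A"
    and p_pos: "\<And>a. a \<in> A \<Longrightarrow> 0 < p a"
    and sum_p: "sum p A = 1"
begin

definition words :: "nat \<Rightarrow> 'b list set" where
  "words n = {l. set l \<subseteq> A \<and> length l = n}"

text \<open>Expectation of \<open>H\<close> at a word of \<open>n\<close> independent letters of law
  \<open>p\<close>. The recursion on the first letter makes the independence of consecutive blocks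
  (\<open>avg_split\<close>) a plain induction.\<close>

primrec avg :: "nat \<Rightarrow> ('b list \<Rightarrow> real) \<Rightarrow> real" where
  "avg 0 H = H []"
| "avg (Suc n) H = (\<Sum>a\<in>A. p a * avg n (\<lambda>l. H (a # l)))"

lemma finite_words: "finite (words n)"
  unfolding words_def using finite_A by (rule finite_lists_length_eq)

lemma Nil_words [simp]: "[] \<in> words 0"
  by (simp add: words_def)

lemma Cons_words [simp]: "a # l \<in> words (Suc n) \<longleftrightarrow> a \<in> A \<and> l \<in> words n"
  by (auto simp: words_def)

lemma words_SucE:
  assumes "l \<in> words (Suc n)"
  obtains a l' where "l = a # l'" "a \<in> A" "l' \<in> words n"
  using assms by (cases l) (auto simp: words_def)

lemma append_words: "l \<in> words m \<Longrightarrow> l' \<in> words n \<Longrightarrow> l @ l' \<in> words (m + n)"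
  by (auto simp: words_def)

lemma window_words: "l \<in> words n \<Longrightarrow> i + d \<le> n \<Longrightarrow> take d (drop i l) \<in> words d"
  by (auto simp: words_def dest!: in_set_takeD in_set_dropD)

lemma avg_mono: "(\<And>l. l \<in> words n \<Longrightarrow> H l \<le> K l) \<Longrightarrow> avg n H \<le> avg n K"
proof (induction n arbitrary: H K)
  case (Suc n)
  then show ?case using p_pos by (auto intro!: sum_mono mult_left_mono simp: less_imp_le)
qed simp

lemma avg_cong: "(\<And>l. l \<in> words n \<Longrightarrow> H l = K l) \<Longrightarrow> avg n H = avg n K"
  by (intro antisym avg_mono) auto

lemma avg_add: "avg n (\<lambda>l. H l + K l) = avg n H + avg n K"
  by (induction n arbitrary: H K) (auto simp: algebra_simps sum.distrib)

lemma avg_cmult: "avg n (\<lambda>l. c * H l) = c * avg n H"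
  by (induction n arbitrary: H) (auto simp: algebra_simps sum_distrib_left)

lemma avg_const [simp]: "avg n (\<lambda>_. c) = c"
  by (induction n) (auto simp: sum_distrib_right[symmetric] sum_p)

lemma avg_diff: "avg n (\<lambda>l. H l - K l) = avg n H - avg n K"
  using avg_add[of n H "\<lambda>l. (-1) * K l"] unfolding avg_cmult by simp

lemma avg_sum: "finite I \<Longrightarrow> avg n (\<lambda>l. \<Sum>i\<in>I. H i l) = (\<Sum>i\<in>I. avg n (H i))"
  by (induction I rule: finite_induct) (auto simp: avg_add)

lemma avg_abs_le: "(\<And>l. l \<in> words n \<Longrightarrow> \<bar>H l\<bar> \<le> C) \<Longrightarrow> \<bar>avg n H\<bar> \<le> C"
  using avg_mono[of n H "\<lambda>_. C"] avg_mono[of n "\<lambda>_. - C" H] by (fastforce simp: abs_le_iff)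

lemma avg_split: "avg (m + n) H = avg m (\<lambda>l. avg n (\<lambda>l'. H (l @ l')))"
  by (induction m arbitrary: H) auto

text \<open>Cutting the word before and after the window leaves a function of the middle block
  alone.\<close>

lemma avg_window:
  assumes "i + d \<le> n"
  shows "avg n (\<lambda>l. H (take d (drop i l))) = avg d H"
proof -
  obtain k where n: "n = i + (d + k)" using assms by (metis add.assoc le_Suc_ex)
  have "avg n (\<lambda>l. H (take d (drop i l))) = avg i (\<lambda>l. avg d (\<lambda>l'. avg k (\<lambda>l''. H l')))"
    unfolding n avg_split by (intro avg_cong arg_cong[of _ _ H]) (auto simp: words_def)
  then show ?thesis by simp
qed

lemma avg_eq_sum: "avg n H = (\<Sum>l\<in>words n. prod_list (map p l) * H l)"
proof (induction n arbitrary: H)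
  case 0
  have "words 0 = {[]}" by (auto simp: words_def)
  then show ?case by simp
next
  case (Suc n)
  have "(\<Sum>l\<in>words (Suc n). prod_list (map p l) * H l)
      = (\<Sum>(a, l)\<in>A \<times> words n. prod_list (map p (a # l)) * H (a # l))"
    by (rule sum.reindex_bij_witness[of _ "\<lambda>(a, l). a # l" "\<lambda>l. (hd l, tl l)"])
       (auto elim!: words_SucE)
  then show ?case
    by (simp add: Suc sum.cartesian_product[symmetric] sum_distrib_left algebra_simps)
qed

text \<open>Of the terms in the average of a nonnegative function only the one for \<open>g\<close>
  is kept; peeling off its letters shows that this word has weight at least
  \<open>s ^ n\<close>.\<close>

lemma avg_ge_weight:
  assumes "0 \<le> s" "\<And>a. a \<in> A \<Longrightarrow> s \<le> p a" "\<And>l. l \<in> words n \<Longrightarrow> 0 \<le> K l" "g \<in> words n"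
  shows "s ^ n * K g \<le> avg n K"
  using assms(3,4)
proof (induction n arbitrary: K g)
  case 0
  then show ?case by (simp add: words_def)
next
  case (Suc n)
  from Suc.prems(2) obtain a g' where g: "g = a # g'" and a: "a \<in> A" and g': "g' \<in> words n"
    by (rule words_SucE)
  have nn: "0 \<le> avg n (\<lambda>l. K (b # l))" if "b \<in> A" for b
    using avg_mono[of n "\<lambda>_. 0" "\<lambda>l. K (b # l)"] Suc.prems(1) that by simp
  have "s ^ Suc n * K g = s * (s ^ n * K (a # g'))" by (simp add: g)
  also have "\<dots> \<le> p a * avg n (\<lambda>l. K (a # l))"
    using assms(1,2) a g' Suc.prems(1) nn p_pos[of a]
    by (intro mult_mono Suc.IH[of "\<lambda>l. K (a # l)"]) (auto intro!: mult_nonneg_nonneg)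
  also have "\<dots> \<le> avg (Suc n) K"
    unfolding avg.simps using finite_A a nn p_pos
    by (intro member_le_sum) (auto intro!: mult_nonneg_nonneg simp: less_imp_le)
  finally show ?case .
qed

text \<open>
  The excess over the average is paid for by the given word \<open>g\<close>, whose weight is at least \<open>s ^ n\<close>.
\<close>

lemma exists_word_above_avg:
  assumes "0 \<le> s" "\<And>a. a \<in> A \<Longrightarrow> s \<le> p a" "g \<in> words n"
  shows "\<exists>b\<in>words n. avg n H + s ^ n * (avg n H - H g) \<le> H b"
proof -
  define m where "m = Max (H ` words n)"
  have le: "H l \<le> m" if "l \<in> words n" for l
    using that finite_words by (auto simp: m_def)
  have "m \<in> H ` words n" unfolding m_def using finite_words assms(3) by (intro Max_in) auto
  then obtain b where b: "b \<in> words n" "H b = m" by auto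
  have "s ^ n * (m - H g) \<le> avg n (\<lambda>l. m - H l)"
    using assms le by (intro avg_ge_weight) auto
  then have 1: "s ^ n * (m - H g) \<le> m - avg n H" by (simp add: avg_diff)
  have "avg n H \<le> m" using avg_mono[of n H "\<lambda>_. m"] le by simp
  then have "s ^ n * (avg n H - H g) \<le> s ^ n * (m - H g)"
    using assms(1) by (intro mult_left_mono) auto
  with 1 b show ?thesis by force
qed

end

text \<open>The function \<open>\<psi> j\<close> is the value of the window that starts at height
  \<open>j\<close> of a column. It depends on \<open>j\<close> because the value also involves the
  class of \<open>Q\<close> met there, which varies along the orbit. It is centred because the
  desired law makes the window independent of that class.\<close>

locale cost_words = letters A p for A :: "'b set" and p +
  fixes d L :: nat and \<psi> :: "nat \<Rightarrow> 'b list \<Rightarrow> real" and C s :: real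
  assumes d_pos: "1 \<le> d" and d_le: "d \<le> L"
    and bound: "\<And>j l. l \<in> words d \<Longrightarrow> \<bar>\<psi> j l\<bar> \<le> C"
    and centred: "\<And>j. avg d (\<psi> j) = 0"
    and s_nonneg: "0 \<le> s" and s_le: "\<And>a. a \<in> A \<Longrightarrow> s \<le> p a" and s_le_1: "s \<le> 1"
    and C_nonneg: "0 \<le> C"
begin

definition \<Phi> :: "nat \<Rightarrow> 'b list \<Rightarrow> 'b list \<Rightarrow> real" where
  "\<Phi> k b b' = (\<Sum>i<L. \<psi> (k * L + i) (take d (drop i (b @ b'))))"

text \<open>
  Cutting a word into blocks of length \<open>L \<ge> d\<close> makes every window meet at most two consecutive
  blocks, so the total cost is the sum of the \<open>\<Phi> k\<close>. The value \<open>h k b\<close> is the expected cost of all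
  windows from block \<open>k\<close> on when that block is \<open>b\<close> and the later letters are i.i.d.
\<close>

definition h :: "nat \<Rightarrow> 'b list \<Rightarrow> real" where
  "h k b = avg L (\<Phi> k b)"

lemma window_words2:
  "b \<in> words L \<Longrightarrow> b' \<in> words L \<Longrightarrow> i < L \<Longrightarrow> take d (drop i (b @ b')) \<in> words d"
  using d_le by (intro window_words[of _ "L + L"] append_words) auto

lemma \<Phi>_bound:
  assumes "b \<in> words L" "b' \<in> words L"
  shows "\<bar>\<Phi> k b b'\<bar> \<le> L * C"
proof -
  have "\<bar>\<Phi> k b b'\<bar> \<le> (\<Sum>i<L. \<bar>\<psi> (k * L + i) (take d (drop i (b @ b')))\<bar>)"
    unfolding \<Phi>_def by (rule sum_abs)
  also have "\<dots> \<le> (\<Sum>i<L. C)" using window_words2[OF assms] bound by (intro sum_mono) auto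
  finally show ?thesis by simp
qed

lemma h_bound: "b \<in> words L \<Longrightarrow> \<bar>h k b\<bar> \<le> L * C"
  unfolding h_def by (intro avg_abs_le \<Phi>_bound)

text \<open>A window inside two independent consecutive blocks is an i.i.d. word, so every summand
  is centred. Hence \<open>h\<close> has mean zero as long as its block is undecided.\<close>

lemma avg_h: "avg L (h k) = 0"
proof -
  have "avg L (h k) = avg (L + L) (\<lambda>l. \<Sum>i<L. \<psi> (k * L + i) (take d (drop i l)))"
    unfolding avg_split h_def \<Phi>_def ..
  also have "\<dots> = (\<Sum>i<L. avg (L + L) (\<lambda>l. \<psi> (k * L + i) (take d (drop i l))))"
    by (simp add: avg_sum)
  also have "\<dots> = 0" using d_le by (intro sum.neutral ballI) (simp add: avg_window centred)
  finally show ?thesis .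
qed

text \<open>Only windows starting at the last \<open>d\<close> places of a block can see the next
  one. The bound therefore does not grow with \<open>L\<close>, which makes the error per level
  small for long blocks.\<close>

lemma \<Phi>_diff:
  assumes "b \<in> words L" "g \<in> words L" "g' \<in> words L"
  shows "\<bar>\<Phi> k b g - \<Phi> k b g'\<bar> \<le> 2 * d * C"
proof -
  let ?t = "\<lambda>g i. \<psi> (k * L + i) (take d (drop i (b @ g)))"
  have eq: "?t g i = ?t g' i" if "i \<in> {..<L} - {L - d..<L}" for i
    using that assms by (auto simp: words_def)
  have "\<Phi> k b g - \<Phi> k b g' = (\<Sum>i<L. ?t g i - ?t g' i)"
    by (simp add: \<Phi>_def sum_subtractf)
  also have "\<dots> = (\<Sum>i\<in>{L - d..<L}. ?t g i - ?t g' i)"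
  proof (rule sum.mono_neutral_right)
    show "\<forall>i\<in>{..<L} - {L - d..<L}. ?t g i - ?t g' i = 0" by (intro ballI) (simp only: eq diff_self)
  qed auto
  finally have "\<bar>\<Phi> k b g - \<Phi> k b g'\<bar> \<le> (\<Sum>i\<in>{L - d..<L}. \<bar>?t g i - ?t g' i\<bar>)"
    by (simp only: sum_abs)
  also have "\<dots> \<le> (\<Sum>i\<in>{L - d..<L}. 2 * C)"
  proof (intro sum_mono)
    fix i assume "i \<in> {L - d..<L}"
    then have "\<bar>?t g i\<bar> \<le> C" "\<bar>?t g' i\<bar> \<le> C"
      using bound[OF window_words2] assms by simp_all
    then show "\<bar>?t g i - ?t g' i\<bar> \<le> 2 * C" by linarith
  qed
  also have "\<dots> = 2 * d * C" using d_le by simp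
  finally show ?thesis .
qed

text \<open>The function \<open>h\<close> is a potential: with \<open>b\<close> fixed, the average
  of \<open>\<Phi> k b b' + h (Suc k) b'\<close> over the next block \<open>b'\<close> is
  \<open>h k b\<close>, because \<open>h (Suc k)\<close> has mean zero. If \<open>g\<close> lies
  below that average, some block lies above it by \<open>s ^ L\<close> times the deficit. The
  deficit is expressed by the value of \<open>g\<close> in its own surroundings: putting
  \<open>g\<close> after \<open>b\<close> and forgetting its successor \<open>g'\<close> cost
  \<open>2 * d * C\<close> each.\<close>

lemma greedy_step:
  assumes b: "b \<in> words L" and g: "g \<in> words L" and g': "g' \<in> words L"
  shows "\<exists>b'\<in>words L. h k b - s ^ L * (\<Phi> (Suc k) g g' + 4 * d * C) \<le> \<Phi> k b b' + h (Suc k) b'"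
proof -
  define H where "H b' = \<Phi> k b b' + h (Suc k) b'" for b'
  have avgH: "avg L H = h k b" unfolding H_def avg_add avg_h by (simp add: h_def)
  have "\<Phi> k b g - h k b = avg L (\<lambda>b'. \<Phi> k b g - \<Phi> k b b')" by (simp add: avg_diff h_def)
  moreover have "\<bar>\<dots>\<bar> \<le> 2 * d * C" using b g by (intro avg_abs_le \<Phi>_diff)
  moreover have "h (Suc k) g - \<Phi> (Suc k) g g' = avg L (\<lambda>b'. \<Phi> (Suc k) g b' - \<Phi> (Suc k) g g')"
    by (simp add: avg_diff h_def)
  moreover have "\<bar>\<dots>\<bar> \<le> 2 * d * C" using g g' by (intro avg_abs_le \<Phi>_diff)
  ultimately have "H g - avg L H \<le> \<Phi> (Suc k) g g' + 4 * d * C" unfolding avgH H_def by linarith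
  then have "s ^ L * (H g - avg L H) \<le> s ^ L * (\<Phi> (Suc k) g g' + 4 * d * C)"
    using s_nonneg by (intro mult_left_mono) auto
  moreover obtain b' where "b' \<in> words L" "avg L H + s ^ L * (avg L H - H g) \<le> H b'"
    using exists_word_above_avg[OF s_nonneg s_le g, of H] by blast
  ultimately show ?thesis unfolding avgH by (intro bexI[of _ b']) (auto simp: H_def algebra_simps)
qed

section \<open>Values of words along one column\<close>

definition cost :: "(nat \<Rightarrow> 'b) \<Rightarrow> nat \<Rightarrow> real" where
  "cost w j = \<psi> j (map w [j..<j + d])"

lemma cost_bound: "(\<And>j. w j \<in> A) \<Longrightarrow> \<bar>cost w j\<bar> \<le> C"
  unfolding cost_def by (intro bound) (auto simp: words_def)

lemma cost_sum_bound:
  assumes "\<And>j. w j \<in> A" "finite J"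
  shows "\<bar>sum (cost w) J\<bar> \<le> card J * C"
proof -
  have "\<bar>sum (cost w) J\<bar> \<le> (\<Sum>j\<in>J. \<bar>cost w j\<bar>)" by (rule sum_abs)
  also have "\<dots> \<le> (\<Sum>j\<in>J. C)" using cost_bound[of w] assms(1) by (intro sum_mono) simp
  finally show ?thesis by simp
qed

lemma \<Phi>_eq_cost:
  assumes "\<And>i. i < 2 * L \<Longrightarrow> w (k * L + i) = (b @ b') ! i" "length b = L" "length b' = L"
  shows "\<Phi> k b b' = (\<Sum>i<L. cost w (k * L + i))"
  unfolding \<Phi>_def cost_def
proof (intro sum.cong refl)
  fix i assume i: "i \<in> {..<L}"
  have "take d (drop i (b @ b')) = map w [k * L + i..<k * L + i + d]"
  proof (rule nth_equalityI)
    show "length (take d (drop i (b @ b'))) = length (map w [k * L + i..<k * L + i + d])"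
      using assms i d_le by auto
  next
    fix m assume "m < length (take d (drop i (b @ b')))"
    then have m: "m < d" by simp
    have *: "w (k * L + (i + m)) = (b @ b') ! (i + m)" using i d_le m by (intro assms(1)) auto
    have "take d (drop i (b @ b')) ! m = (b @ b') ! (i + m)"
      using assms(2,3) i d_le m by (subst nth_take, simp, subst nth_drop) auto
    with * show "take d (drop i (b @ b')) ! m = map w [k * L + i..<k * L + i + d] ! m"
      using m by (simp add: add.assoc)
  qed
  then show "\<psi> (k * L + i) (take d (drop i (b @ b'))) = \<psi> (k * L + i) (map w [k * L + i..<k * L + i + d])"
    by simp
qed

lemma sum_blocks: "(\<Sum>k<K. \<Sum>i<L. F (k * L + i)) = (\<Sum>j<K * L. F j :: real)"
proof -
  have "(\<Sum>i<L. F (k * L + i)) = sum F {k * L..<k * L + L}" for k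
    by (subst sum.atLeastLessThan_shift_0) (simp add: lessThan_atLeast0)
  then show ?thesis by (simp add: sum.nat_group)
qed

text \<open>From a forced block of letters \<open>a\<close> on, \<open>greedy_step\<close> is
  iterated against the blocks of \<open>g\<close>, and the potential \<open>h\<close> telescopes.
  The prefix has length \<open>L\<close> rather than \<open>d\<close> so that it fills exactly one
  block.\<close>

lemma greedy_column:
  assumes a: "a \<in> A" and g: "\<And>j. g j \<in> A"
  shows "\<exists>w. (\<forall>j. w j \<in> A) \<and> (\<forall>j<L. w j = a) \<and> (\<forall>j\<ge>r. w j = a) \<and>
    (\<Sum>j<r. cost w j) \<ge> - (s ^ L) * (\<Sum>j<r. cost g j) - s ^ L * (4 * d * C) * (r / L) - 7 * L * C"
proof -
  have L: "L > 0" using d_pos d_le by auto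
  have sL: "0 \<le> s ^ L" "s ^ L \<le> 1" using s_nonneg s_le_1 by (auto simp: power_le_one)
  have dC: "0 \<le> 4 * real d * C" using C_nonneg by simp
  have err: "0 \<le> s ^ L * (4 * d * C) * (r / L)" using sL dC by simp
  show ?thesis
  proof (cases "r < 2 * L")
    \<comment> \<open>The column is too short for a greedy step. It has fewer than
      \<open>2 * L\<close> windows, so the constant word and the scaled value of \<open>g\<close>
      account for at most \<open>2 * L * C\<close> each.\<close>
    case True
    have "\<bar>\<Sum>j<r. cost (\<lambda>_. a) j\<bar> \<le> r * C" "\<bar>\<Sum>j<r. cost g j\<bar> \<le> r * C"
      using cost_sum_bound[of "\<lambda>_. a" "{..<r}"] cost_sum_bound[of g "{..<r}"] a g by auto
    moreover have "r * C \<le> 2 * L * C"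
      using True C_nonneg by (intro mult_right_mono) linarith+
    moreover have "\<bar>s ^ L * (\<Sum>j<r. cost g j)\<bar> \<le> 1 * \<bar>\<Sum>j<r. cost g j\<bar>"
      unfolding abs_mult using sL by (intro mult_mono) auto
    moreover have "0 \<le> L * C" using C_nonneg by simp
    ultimately have "(\<Sum>j<r. cost (\<lambda>_. a) j)
        \<ge> - (s ^ L) * (\<Sum>j<r. cost g j) - s ^ L * (4 * d * C) * (r / L) - 7 * L * C"
      using err by (simp only: mult_minus_left)
    then show ?thesis using a by (intro exI[of _ "\<lambda>_. a"]) auto
  next
    case False
    define gb where "gb k = map g [k * L..<k * L + L]" for k
    have gb: "gb k \<in> words L" for k using g by (auto simp: gb_def words_def)
    have gb_nth: "g (k * L + i) = (gb k @ gb (Suc k)) ! i" if "i < 2 * L" for k i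
      using that by (auto simp: gb_def nth_append algebra_simps)
    define b0 where "b0 = replicate L a"
    have b0: "b0 \<in> words L" using a by (auto simp: b0_def words_def)
    have "\<exists>B. \<forall>k. (B k \<in> words L \<and> (k = 0 \<longrightarrow> B k = b0)) \<and>
      (h k (B k) - s ^ L * (\<Phi> (Suc k) (gb (Suc k)) (gb (Suc (Suc k))) + 4 * d * C)
         \<le> \<Phi> k (B k) (B (Suc k)) + h (Suc k) (B (Suc k)))"
    proof (rule dependent_nat_choice)
      show "\<exists>x. x \<in> words L \<and> ((0::nat) = 0 \<longrightarrow> x = b0)" using b0 by simp
    next
      fix x and k :: nat assume "x \<in> words L \<and> (k = 0 \<longrightarrow> x = b0)"
      then show "\<exists>y. (y \<in> words L \<and> (Suc k = 0 \<longrightarrow> y = b0)) \<and>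
          h k x - s ^ L * (\<Phi> (Suc k) (gb (Suc k)) (gb (Suc (Suc k))) + 4 * d * C)
            \<le> \<Phi> k x y + h (Suc k) y"
        using greedy_step[OF _ gb gb, of x k "Suc k" "Suc (Suc k)"] by blast
    qed
    then obtain B where B': "\<forall>k. (B k \<in> words L \<and> (k = 0 \<longrightarrow> B k = b0)) \<and>
      (h k (B k) - s ^ L * (\<Phi> (Suc k) (gb (Suc k)) (gb (Suc (Suc k))) + 4 * d * C)
         \<le> \<Phi> k (B k) (B (Suc k)) + h (Suc k) (B (Suc k)))" by (elim exE)
    have B: "B k \<in> words L" and B0: "B 0 = b0"
      and step: "h k (B k) - s ^ L * (\<Phi> (Suc k) (gb (Suc k)) (gb (Suc (Suc k))) + 4 * d * C)
         \<le> \<Phi> k (B k) (B (Suc k)) + h (Suc k) (B (Suc k))" for k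
      using B' by blast+
    \<comment> \<open>There are \<open>K + 1\<close> complete blocks, numbered from
      \<open>0\<close>. The last of them has no complete successor, so only \<open>K\<close> greedy
      steps are taken; its windows and those of the remainder are estimated trivially.\<close>
    define K where "K = r div L - 1"
    have K1: "K + 1 = r div L" using False L by (simp add: K_def div_greater_zero_iff)
    have rL: "(K + 1) * L \<le> r" "r < (K + 1) * L + L"
      unfolding K1 using div_times_less_eq_dividend[of r L] dividend_less_div_times[OF L, of r]
      by (simp_all add: add.commute)
    define w where "w j = (if j < (K + 1) * L then B (j div L) ! (j mod L) else a)" for j
    have lenB: "length (B k) = L" for k using B by (simp add: words_def)
    have wA: "w j \<in> A" for j
    proof -
      have "B (j div L) ! (j mod L) \<in> set (B (j div L))" using L lenB by (intro nth_mem) simp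
      then show ?thesis using B[of "j div L"] a by (auto simp: w_def words_def)
    qed
    have w0: "w j = a" if "j < L" for j using that by (auto simp: w_def B0 b0_def)
    have w1: "w j = a" if "j \<ge> r" for j using that rL by (auto simp: w_def)
    have \<Phi>w: "\<Phi> k (B k) (B (Suc k)) = (\<Sum>i<L. cost w (k * L + i))" if "k < K" for k
    proof (rule \<Phi>_eq_cost[OF _ lenB lenB])
      fix i assume i: "i < 2 * L"
      have "(k + 2) * L \<le> (K + 1) * L" using that by (intro mult_le_mono1) auto
      then have lt: "k * L + i < (K + 1) * L" using i by (simp add: algebra_simps)
      show "w (k * L + i) = (B k @ B (Suc k)) ! i"
      proof (cases "i < L")
        case True
        then show ?thesis using lt by (simp add: w_def nth_append lenB)
      next
        case False
        then obtain i' where i': "i = L + i'" "i' < L" using i by (metis add_diff_inverse_nat less_diff_conv2 mult_2 not_less)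
        have eq: "k * L + i = i' + Suc k * L" by (simp add: i')
        have "(k * L + i) div L = Suc k" "(k * L + i) mod L = i'"
          unfolding eq using i' L by (simp_all only: div_mult_self1 mod_mult_self1) simp_all
        then show ?thesis using lt i' by (simp add: w_def nth_append lenB)
      qed
    qed
    have \<Phi>g: "\<Phi> k (gb k) (gb (Suc k)) = (\<Sum>i<L. cost g (k * L + i))" for k
      by (rule \<Phi>_eq_cost) (use gb_nth gb in \<open>auto simp: words_def\<close>)
    have iter: "h 0 (B 0) - s ^ L * ((\<Sum>k<n. \<Phi> (Suc k) (gb (Suc k)) (gb (Suc (Suc k)))) + n * (4 * d * C))
        \<le> (\<Sum>k<n. \<Phi> k (B k) (B (Suc k))) + h n (B n)" for n
    proof (induction n)
      case (Suc n)
      then show ?case using step[of n] by (simp add: algebra_simps)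
    qed simp
    \<comment> \<open>Step \<open>k\<close> is measured against block \<open>Suc k\<close> of
      \<open>g\<close>, so block \<open>0\<close> of \<open>g\<close> does not enter and has to be
      restored.\<close>
    have "(\<Sum>k<Suc K. \<Phi> k (gb k) (gb (Suc k))) = (\<Sum>j<Suc K * L. cost g j)"
      unfolding \<Phi>g sum_blocks ..
    then have sg: "(\<Sum>k<K. \<Phi> (Suc k) (gb (Suc k)) (gb (Suc (Suc k)))) = (\<Sum>j<Suc K * L. cost g j) - \<Phi> 0 (gb 0) (gb (Suc 0))"
      by (subst (asm) sum.lessThan_Suc_shift) simp
    have sw: "(\<Sum>k<K. \<Phi> k (B k) (B (Suc k))) = (\<Sum>j<K * L. cost w j)"
      unfolding sum_blocks[symmetric] by (intro sum.cong refl \<Phi>w) simp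
    have tail: "(\<Sum>j<r. cost v j) = (\<Sum>j<m. cost v j) + sum (cost v) {m..<r}" if "m \<le> r" for v m
      using that by (simp add: lessThan_atLeast0 sum.atLeastLessThan_concat)
    have t1: "\<bar>sum (cost w) {K * L..<r}\<bar> \<le> 2 * L * C"
    proof -
      have "r - K * L \<le> 2 * L" using rL by simp
      then have "real (r - K * L) * C \<le> real (2 * L) * C" using C_nonneg by (intro mult_right_mono) (simp_all only: of_nat_le_iff)
      then show ?thesis using cost_sum_bound[of w "{K * L..<r}"] wA by simp
    qed
    have t2: "\<bar>sum (cost g) {Suc K * L..<r}\<bar> \<le> L * C"
    proof -
      have "r - Suc K * L \<le> L" using rL by simp
      then have "real (r - Suc K * L) * C \<le> real L * C" using C_nonneg by (intro mult_right_mono) (simp_all only: of_nat_le_iff)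
      then show ?thesis using cost_sum_bound[of g "{Suc K * L..<r}"] g by simp
    qed
    define Y where "Y = (\<Sum>k<K. \<Phi> (Suc k) (gb (Suc k)) (gb (Suc (Suc k))))"
    have Yle: "Y \<le> (\<Sum>j<r. cost g j) + 2 * L * C"
      using tail[of "Suc K * L" g] rL t2 \<Phi>_bound[OF gb gb, of 0 0 "Suc 0"] unfolding Y_def sg by auto
    have "s ^ L * Y \<le> s ^ L * ((\<Sum>j<r. cost g j) + 2 * L * C)"
      using Yle sL by (intro mult_left_mono) auto
    also have "\<dots> \<le> s ^ L * (\<Sum>j<r. cost g j) + 2 * L * C"
      using mult_right_mono[OF sL(2), of "2 * L * C"] C_nonneg by (simp add: algebra_simps)
    finally have sY: "s ^ L * Y \<le> s ^ L * (\<Sum>j<r. cost g j) + 2 * L * C" .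
    have KrL: "real K \<le> r / L"
    proof -
      have "K * L \<le> r" using rL by simp
      then have "real K * real L \<le> real r" by (metis of_nat_le_iff of_nat_mult)
      then show ?thesis using L by (simp add: field_simps)
    qed
    have sK: "s ^ L * (4 * d * C) * K \<le> s ^ L * (4 * d * C) * (r / L)"
      using KrL sL(1) dC by (intro mult_left_mono) auto
    have tw: "(\<Sum>j<r. cost w j) = (\<Sum>k<K. \<Phi> k (B k) (B (Suc k))) + sum (cost w) {K * L..<r}"
      unfolding sw by (rule tail) (use rL in simp)
    have split: "s ^ L * (Y + K * (4 * d * C)) = s ^ L * Y + s ^ L * (4 * d * C) * K"
      by (simp add: algebra_simps)
    have itK: "h 0 (B 0) - (s ^ L * Y + s ^ L * (4 * d * C) * K)
        \<le> (\<Sum>k<K. \<Phi> k (B k) (B (Suc k))) + h K (B K)"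
      using iter[of K] unfolding Y_def[symmetric] split .
    have hb: "- (L * C) \<le> h 0 (B 0)" "h K (B K) \<le> L * C"
      using h_bound[OF B[of 0], of 0] h_bound[OF B[of K], of K] by linarith+
    have LC: "0 \<le> L * C" using C_nonneg by simp
    have t1': "- (2 * L * C) \<le> sum (cost w) {K * L..<r}" using t1 by linarith
    \<comment> \<open>Six multiples of \<open>L * C\<close> are spent: one each for
      \<open>h 0 (B 0)\<close> and \<open>h K (B K)\<close>, two for the end of \<open>w\<close>,
      two for replacing \<open>Y\<close> by the full value of \<open>g\<close>. The seventh is
      slack.\<close>
    have "(\<Sum>j<r. cost w j) \<ge> - (s ^ L) * (\<Sum>j<r. cost g j) - s ^ L * (4 * d * C) * (r / L) - 7 * L * C"
      using itK hb t1' sK sY LC unfolding tw mult_minus_left by (simp only: of_nat_mult of_nat_numeral)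
    then show ?thesis using wA w0 w1 by (intro exI[of _ w]) simp
  qed
qed

end

subsection \<open>Columns over a set of positive measure\<close>

lemma funpow_measurable [measurable]: "T \<in> measurable M M \<Longrightarrow> T ^^ n \<in> measurable M M"
  by (induction n) (auto intro: measurable_comp)

lemma nn_integral_funpow:
  assumes [measurable]: "T \<in> measurable M M" "g \<in> borel_measurable M" and inv: "distr M M T = M"
  shows "(\<integral>\<^sup>+x. g ((T ^^ n) x) \<partial>M) = (\<integral>\<^sup>+x. g x \<partial>M)"
proof (induction n)
  case (Suc n)
  have "(\<integral>\<^sup>+x. g ((T ^^ n) x) \<partial>M) = (\<integral>\<^sup>+x. g ((T ^^ n) x) \<partial>distr M M T)"
    unfolding inv ..
  also have "\<dots> = (\<integral>\<^sup>+x. g ((T ^^ n) (T x)) \<partial>M)"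
    by (subst nn_integral_distr) auto
  finally show ?case using Suc by (simp add: funpow_swap1)
qed simp

lemma INFM_Suc: "(\<exists>\<^sub>\<infinity>j. P (Suc j)) \<longleftrightarrow> (\<exists>\<^sub>\<infinity>j. P j)"
  unfolding frequently_def cofinite_eq_sequentially
  using eventually_sequentially_Suc[of "\<lambda>j. \<not> P j"] by simp

text \<open>The set \<open>R\<close> of points with infinitely many visits is exactly invariant, as
  \<open>ergodic\<close> demands. Its measure is at least that of \<open>E\<close>, because it is
  the decreasing limit of the sets \<open>Q n\<close>, each of which contains the preimage of
  \<open>E\<close> under \<open>T ^^ n\<close>.\<close>

lemma AE_infinitely_often_visits:
  assumes "prob_space M" and T [measurable]: "T \<in> measurable M M" and inv: "distr M M T = M"
    and erg: "ergodic M T" and E [measurable]: "E \<in> sets M" and pos: "measure M E > 0"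
  shows "AE x in M. \<exists>\<^sub>\<infinity>j. (T ^^ j) x \<in> E"
proof -
  interpret prob_space M by fact
  define Q where "Q n = {x\<in>space M. \<exists>m\<ge>n. (T ^^ m) x \<in> E}" for n
  define R where "R = {x\<in>space M. \<exists>\<^sub>\<infinity>j. (T ^^ j) x \<in> E}"
  have Q [measurable]: "Q n \<in> sets M" for n unfolding Q_def by measurable
  have R_Q: "R = (\<Inter>n. Q n)" by (auto simp: R_def Q_def INFM_nat_le)
  have R [measurable]: "R \<in> sets M" unfolding R_Q by measurable
  have dec: "decseq Q" by (auto simp: decseq_def Q_def intro: order_trans)
  have ge: "prob E \<le> prob (Q n)" for n
  proof -
    have "emeasure M E = (\<integral>\<^sup>+x. indicator E ((T ^^ n) x) \<partial>M)"
      by (subst nn_integral_funpow[OF T _ inv]) auto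
    also have "\<dots> \<le> (\<integral>\<^sup>+x. indicator (Q n) x \<partial>M)"
      by (intro nn_integral_mono) (auto simp: Q_def split: split_indicator)
    finally show ?thesis by (simp add: emeasure_eq_measure)
  qed
  have "(\<lambda>n. prob (Q n)) \<longlonglongrightarrow> prob R"
    unfolding R_Q using dec Q by (intro finite_Lim_measure_decseq) auto
  then have ER: "prob E \<le> prob R" using ge by (intro LIMSEQ_le_const) auto
  have "T -` R \<inter> space M = R"
  proof -
    have "(\<exists>\<^sub>\<infinity>j. (T ^^ j) (T x) \<in> E) \<longleftrightarrow> (\<exists>\<^sub>\<infinity>j. (T ^^ j) x \<in> E)" for x
      using INFM_Suc[of "\<lambda>j. (T ^^ j) x \<in> E"] by (simp add: funpow_swap1)
    then show ?thesis using measurable_space[OF T] by (auto simp: R_def)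
  qed
  then have "prob R = 0 \<or> prob R = 1" using erg R unfolding ergodic_def by blast
  then have "prob R = 1" using pos ER by linarith
  then show ?thesis using AE_prob_1[of R] by (auto simp: R_def)
qed

text \<open>Standardness enters through the measurable injection \<open>U\<close> into the reals:
  intervals with rational ends separate the points of an orbit, and the distribution of
  \<open>U\<close> can be cut at any proportion.\<close>

locale aperiodic_system = prob_space M for M :: "'x measure" +
  fixes T S :: "'x \<Rightarrow> 'x" and U :: "'x \<Rightarrow> real"
  assumes T_meas [measurable]: "T \<in> measurable M M"
    and S_meas [measurable]: "S \<in> measurable M M"
    and distr_T: "distr M M T = M"
    and ST: "\<And>x. x \<in> space M \<Longrightarrow> S (T x) = x"
    and TS: "\<And>x. x \<in> space M \<Longrightarrow> T (S x) = x"
    and ergodic_T: "ergodic M T"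
    and aperiodic_T: "aperiodic M T"
    and U_meas [measurable]: "U \<in> borel_measurable M"
    and U_inj: "inj_on U (space M)"
begin

section \<open>Columns and Kac's formula\<close>

lemma T_space [simp]: "x \<in> space M \<Longrightarrow> T x \<in> space M"
  using measurable_space[OF T_meas] .

lemma S_space [simp]: "x \<in> space M \<Longrightarrow> S x \<in> space M"
  using measurable_space[OF S_meas] .

lemma Tn_space [simp]: "x \<in> space M \<Longrightarrow> (T ^^ n) x \<in> space M"
  by (induction n) auto

lemma Sn_space [simp]: "x \<in> space M \<Longrightarrow> (S ^^ n) x \<in> space M"
  by (induction n) auto

lemma S_Tn: "x \<in> space M \<Longrightarrow> i \<le> j \<Longrightarrow> (S ^^ i) ((T ^^ j) x) = (T ^^ (j - i)) x"
proof (induction i)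
  case (Suc i)
  then have "(S ^^ Suc i) ((T ^^ j) x) = S ((T ^^ (j - i)) x)" by simp
  also have "j - i = Suc (j - Suc i)" using Suc by simp
  finally show ?case using Suc by (simp add: ST)
qed simp

lemma T_Sn: "x \<in> space M \<Longrightarrow> i \<le> j \<Longrightarrow> (T ^^ i) ((S ^^ j) x) = (S ^^ (j - i)) x"
proof (induction i)
  case (Suc i)
  then have "(T ^^ Suc i) ((S ^^ j) x) = T ((S ^^ (j - i)) x)" by simp
  also have "j - i = Suc (j - Suc i)" using Suc by simp
  finally show ?case using Suc by (simp add: TS)
qed simp

lemma distr_S: "distr M M S = M"
proof -
  have "distr M M S = distr (distr M M T) M S" by (simp add: distr_T)
  also have "\<dots> = distr M M (\<lambda>x. x)"
    unfolding distr_distr[OF S_meas T_meas] by (rule distr_cong) (simp_all add: ST)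
  finally show ?thesis by (simp add: distr_id2)
qed

lemma ergodic_S: "ergodic M S"
  unfolding ergodic_def
proof (intro ballI impI)
  fix B assume B: "B \<in> sets M" and eq: "S -` B \<inter> space M = B"
  have iff: "S y \<in> B \<longleftrightarrow> y \<in> B" if "y \<in> space M" for y using eq that by (auto simp: set_eq_iff)
  have "T x \<in> B \<longleftrightarrow> x \<in> B" if "x \<in> space M" for x using iff[of "T x"] that by (simp add: ST)
  then have "T -` B \<inter> space M = B" using sets.sets_into_space[OF B] by auto
  then show "measure M B = 0 \<or> measure M B = 1" using ergodic_T B by (auto simp: ergodic_def)
qed

text \<open>Infinitely many visits in both directions make the column of the point finite and give
  it a base point.\<close>

definition good :: "'x set \<Rightarrow> 'x \<Rightarrow> bool" where
  "good E x \<longleftrightarrow> x \<in> space M \<and> (\<exists>\<^sub>\<infinity>j. (T ^^ j) x \<in> E) \<and> (\<exists>\<^sub>\<infinity>j. (S ^^ j) x \<in> E)"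

lemma AE_good:
  assumes "E \<in> sets M" "prob E > 0"
  shows "AE x in M. good E x"
  using AE_infinitely_often_visits[OF prob_space_axioms T_meas distr_T ergodic_T assms]
    AE_infinitely_often_visits[OF prob_space_axioms S_meas distr_S ergodic_S assms] AE_space
  by eventually_elim (auto simp: good_def)

lemma good_T: "good E x \<Longrightarrow> good E (T x)"
proof -
  assume x: "good E x"
  have "(\<exists>\<^sub>\<infinity>j. (T ^^ j) (T x) \<in> E)"
    using x INFM_Suc[of "\<lambda>j. (T ^^ j) x \<in> E"] by (simp add: good_def funpow_swap1)
  moreover have "(\<exists>\<^sub>\<infinity>j. (S ^^ j) (T x) \<in> E)"
    unfolding INFM_nat_le
  proof
    fix m
    obtain j where "j \<ge> m" "(S ^^ j) x \<in> E" using x by (auto simp: good_def INFM_nat_le)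
    then have "(S ^^ Suc j) (T x) \<in> E" using x by (simp add: funpow_Suc_right ST good_def del: funpow.simps)
    then show "\<exists>n\<ge>m. (S ^^ n) (T x) \<in> E" using \<open>j \<ge> m\<close> by (meson le_SucI)
  qed
  ultimately show ?thesis using x by (auto simp: good_def)
qed

lemma good_Tn: "good E x \<Longrightarrow> good E ((T ^^ n) x)"
  by (induction n) (auto intro: good_T)

text \<open>A column consists of a point of \<open>E\<close> and its iterates up to, but excluding,
  the next visit. \<open>level\<close> counts the steps back to the last visit, with
  \<open>0\<close> on \<open>E\<close>; \<open>height\<close> is the first positive time of a visit,
  hence at least \<open>1\<close>. Off the \<open>good\<close> points the values carry no meaning
  but are still measurable.\<close>

definition level :: "'x set \<Rightarrow> 'x \<Rightarrow> nat" where
  "level E x = (LEAST n. (S ^^ n) x \<in> E)"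

definition base :: "'x set \<Rightarrow> 'x \<Rightarrow> 'x" where
  "base E x = (S ^^ level E x) x"

definition height :: "'x set \<Rightarrow> 'x \<Rightarrow> nat" where
  "height E x = Suc (LEAST n. (T ^^ Suc n) x \<in> E)"

lemma level_meas [measurable]:
  assumes [measurable]: "E \<in> sets M"
  shows "level E \<in> measurable M (count_space UNIV)"
  unfolding level_def[abs_def] by measurable

lemma height_meas [measurable]:
  assumes [measurable]: "E \<in> sets M"
  shows "height E \<in> measurable M (count_space UNIV)"
  unfolding height_def[abs_def] by measurable

lemma base_meas [measurable]:
  assumes [measurable]: "E \<in> sets M"
  shows "base E \<in> measurable M M"
  unfolding base_def[abs_def] by (rule measurable_compose_countable[of "\<lambda>n x. (S ^^ n) x"]) measurable

lemma height_pos [simp]: "0 < height E x"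
  by (simp add: height_def)

lemma T_height: "good E x \<Longrightarrow> (T ^^ height E x) x \<in> E"
  unfolding height_def good_def INFM_nat_le
  by (rule LeastI_ex) (metis Suc_le_D)

lemma less_height_iff:
  assumes "good E x"
  shows "j < height E x \<longleftrightarrow> (\<forall>i. 0 < i \<longrightarrow> i \<le> j \<longrightarrow> (T ^^ i) x \<notin> E)"
proof
  assume j: "j < height E x"
  show "\<forall>i. 0 < i \<longrightarrow> i \<le> j \<longrightarrow> (T ^^ i) x \<notin> E"
  proof (intro allI impI)
    fix i assume i: "0 < i" "i \<le> j"
    then obtain i' where "i = Suc i'" by (cases i) auto
    with i j show "(T ^^ i) x \<notin> E"
      using not_less_Least[of i' "\<lambda>n. (T ^^ Suc n) x \<in> E"] unfolding height_def by auto
  qed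
next
  assume "\<forall>i. 0 < i \<longrightarrow> i \<le> j \<longrightarrow> (T ^^ i) x \<notin> E"
  then show "j < height E x" using T_height[OF assms] height_pos[of E x] by (meson not_less)
qed

text \<open>The way back from \<open>(T ^^ j) x\<close> runs through the earlier iterates of
  \<open>x\<close>, so the last visit is at \<open>x\<close> itself exactly if \<open>x\<close> lies
  in \<open>E\<close> and no visit intervenes.\<close>

lemma level_iff:
  assumes "good E x"
  shows "level E ((T ^^ j) x) = j \<longleftrightarrow> x \<in> E \<and> j < height E x"
proof -
  have x: "x \<in> space M" using assms by (simp add: good_def)
  have ex: "\<exists>n. (S ^^ n) ((T ^^ j) x) \<in> E"
    using good_Tn[OF assms, of j] by (auto simp: good_def INFM_nat_le)
  have "level E ((T ^^ j) x) = j \<longleftrightarrow> (S ^^ j) ((T ^^ j) x) \<in> E \<and> (\<forall>i<j. (S ^^ i) ((T ^^ j) x) \<notin> E)"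
    unfolding level_def using LeastI_ex[OF ex] not_less_Least[of _ "\<lambda>n. (S ^^ n) ((T ^^ j) x) \<in> E"]
    by (metis Least_equality not_less)
  also have "\<dots> \<longleftrightarrow> x \<in> E \<and> (\<forall>i<j. (T ^^ (j - i)) x \<notin> E)" using S_Tn[OF x] by auto
  also have "(\<forall>i<j. (T ^^ (j - i)) x \<notin> E) \<longleftrightarrow> (\<forall>i. 0 < i \<longrightarrow> i \<le> j \<longrightarrow> (T ^^ i) x \<notin> E)"
  proof safe
    fix i assume "\<forall>i<j. (T ^^ (j - i)) x \<notin> E" "0 < i" "i \<le> j" "(T ^^ i) x \<in> E"
    then show False by (metis diff_diff_cancel diff_less order_less_le_trans)
  qed auto
  finally show ?thesis by (simp only: less_height_iff[OF assms])
qed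

lemma level_base: "good E x \<Longrightarrow> x \<in> E \<Longrightarrow> j < height E x \<Longrightarrow> level E ((T ^^ j) x) = j \<and> base E ((T ^^ j) x) = x"
  using level_iff[of E x j] S_Tn[of x j j] by (auto simp: base_def good_def)

text \<open>Kac's formula for functions. The space is split by level, and the part at level
  \<open>j\<close> is moved down to the base by invariance under \<open>T ^^ j\<close>; by
  \<open>level_iff\<close> the points contributing for \<open>j\<close> are those of
  \<open>E\<close> with height above \<open>j\<close>.\<close>

lemma kac:
  assumes E [measurable]: "E \<in> sets M" and pos: "prob E > 0" and [measurable]: "g \<in> borel_measurable M"
  shows "(\<integral>\<^sup>+x. g x \<partial>M) = (\<integral>\<^sup>+x. indicator E x * (\<Sum>j<height E x. g ((T ^^ j) x)) \<partial>M)"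
proof -
  let ?G = "\<lambda>j x. g x * indicator {x\<in>space M. level E x = j} x"
  have "(\<Sum>j. ?G j x) = g x" if "x \<in> space M" for x
    using that by (subst suminf_finite[of "{level E x}"]) auto
  then have "(\<integral>\<^sup>+x. g x \<partial>M) = (\<integral>\<^sup>+x. (\<Sum>j. ?G j x) \<partial>M)"
    by (intro nn_integral_cong) simp
  also have "\<dots> = (\<Sum>j. \<integral>\<^sup>+x. ?G j x \<partial>M)"
    by (intro nn_integral_suminf) measurable
  also have "\<dots> = (\<Sum>j. \<integral>\<^sup>+x. ?G j ((T ^^ j) x) \<partial>M)"
    by (subst nn_integral_funpow[OF T_meas _ distr_T]) auto
  also have "\<dots> = (\<integral>\<^sup>+x. (\<Sum>j. ?G j ((T ^^ j) x)) \<partial>M)"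
    by (intro nn_integral_suminf[symmetric]) measurable
  also have "\<dots> = (\<integral>\<^sup>+x. indicator E x * (\<Sum>j<height E x. g ((T ^^ j) x)) \<partial>M)"
  proof (intro nn_integral_cong_AE)
    show "AE x in M. (\<Sum>j. ?G j ((T ^^ j) x)) = indicator E x * (\<Sum>j<height E x. g ((T ^^ j) x))"
      using AE_good[OF E pos]
    proof eventually_elim
      case (elim x)
      then have x: "x \<in> space M" by (simp add: good_def)
      have "(\<Sum>j. ?G j ((T ^^ j) x)) = (\<Sum>j<height E x. ?G j ((T ^^ j) x))"
        using elim level_iff by (intro suminf_finite) auto
      also have "\<dots> = indicator E x * (\<Sum>j<height E x. g ((T ^^ j) x))"
        unfolding sum_distrib_left using x level_iff[OF elim]
        by (intro sum.cong refl) (auto split: split_indicator)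
      finally show ?case .
    qed
  qed
  finally show ?thesis .
qed

text \<open>By aperiodicity, \<open>U\<close> takes values different from \<open>U x\<close> at the
  next iterates of almost every \<open>x\<close>, so some rational interval around
  \<open>U x\<close> avoids finitely many of them. There are countably many such intervals, hence
  one of the sets \<open>V\<close> is not null.\<close>

lemma exists_base:
  assumes D [measurable]: "D \<in> sets M" and pos: "prob D > 0"
  shows "\<exists>E\<in>sets M. E \<subseteq> D \<and> prob E > 0 \<and> (\<forall>x\<in>E. \<forall>j. 0 < j \<longrightarrow> j < N \<longrightarrow> (T ^^ j) x \<notin> E)"
proof -
  define V where "V = (\<lambda>(a, b). {x\<in>D. a < U x \<and> U x < b \<and>
    (\<forall>j\<in>{1..<N}. \<not> (a < U ((T ^^ j) x) \<and> U ((T ^^ j) x) < b))})"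
  have V [measurable]: "V ab \<in> sets M" for ab
  proof -
    have "V ab = {x\<in>space M. x \<in> D \<and> fst ab < U x \<and> U x < snd ab \<and>
      (\<forall>j\<in>{1..<N}. \<not> (fst ab < U ((T ^^ j) x) \<and> U ((T ^^ j) x) < snd ab))}"
      using sets.sets_into_space[OF D] by (auto simp: V_def split: prod.splits)
    also have "\<dots> \<in> sets M" by measurable
    finally show ?thesis .
  qed
  let ?R = "\<rat> \<times> \<rat> :: (real \<times> real) set"
  have ct: "countable ?R" using countable_rat by blast
  have "AE x in M. x \<in> D \<longrightarrow> x \<in> (\<Union>ab\<in>?R. V ab)"
    using aperiodic_T[unfolded aperiodic_def] AE_space
  proof eventually_elim
    case (elim x)
    show ?case
    proof
      assume x: "x \<in> D"
      let ?F = "insert 1 ((\<lambda>j. \<bar>U ((T ^^ j) x) - U x\<bar>) ` {1..<N})"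
      define e where "e = Min ?F"
      have "0 < e"
        unfolding e_def using elim inj_onD[OF U_inj, of "(T ^^ _) x" x] by (subst Min_gr_iff) auto
      obtain a where a: "a \<in> \<rat>" "U x - e < a" "a < U x"
        using Rats_dense_in_real[of "U x - e" "U x"] \<open>0 < e\<close> by auto
      obtain b where b: "b \<in> \<rat>" "U x < b" "b < U x + e"
        using Rats_dense_in_real[of "U x" "U x + e"] \<open>0 < e\<close> by auto
      have "e \<le> \<bar>U ((T ^^ j) x) - U x\<bar>" if "j \<in> {1..<N}" for j
        unfolding e_def using that by (intro Min_le) auto
      then have "x \<in> V (a, b)" using x a b unfolding V_def by force
      then show "x \<in> (\<Union>ab\<in>?R. V ab)" using a b by blast
    qed
  qed
  then have "\<not> (\<forall>ab\<in>?R. V ab \<in> null_sets M)"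
  proof (intro notI)
    assume *: "AE x in M. x \<in> D \<longrightarrow> x \<in> (\<Union>ab\<in>?R. V ab)" and "\<forall>ab\<in>?R. V ab \<in> null_sets M"
    then have "(\<Union>ab\<in>?R. V ab) \<in> null_sets M" using ct by (intro null_sets_UN') auto
    then have "AE x in M. x \<notin> (\<Union>ab\<in>?R. V ab)" by (rule AE_not_in)
    with * have "AE x in M. x \<notin> D" by eventually_elim auto
    then have "prob D = 0" by (subst (asm) AE_iff_null_sets[symmetric]) (auto simp: measure_eq_0_null_sets)
    with pos show False by simp
  qed
  then obtain ab where "V ab \<notin> null_sets M" by auto
  then have "prob (V ab) > 0" using V[of ab] by (auto simp: null_sets_def emeasure_eq_measure zero_less_measure_iff)
  then show ?thesis using V[of ab]
    by (intro bexI[of _ "V ab"]) (auto simp: V_def split: prod.splits)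
qed

section \<open>Small bases, absence of atoms, independent sets\<close>

lemma height_ge:
  assumes "good E x" "x \<in> E" "\<And>j. 0 < j \<Longrightarrow> j < N \<Longrightarrow> (T ^^ j) x \<notin> E"
  shows "N \<le> height E x"
  using T_height[OF assms(1)] assms(3)[of "height E x"] by (meson height_pos not_le)

text \<open>By Kac's formula for the constant \<open>1\<close>, the columns over \<open>E\<close>
  have total mass \<open>1\<close>, and each has height at least \<open>N\<close>.\<close>

lemma prob_base:
  fixes N :: nat
  assumes E [measurable]: "E \<in> sets M" and pos: "prob E > 0"
    and sep: "\<And>x j. x \<in> E \<Longrightarrow> 0 < j \<Longrightarrow> j < N \<Longrightarrow> (T ^^ j) x \<notin> E"
  shows "N * prob E \<le> 1"
proof -
  have "ennreal (N * prob E) = (\<integral>\<^sup>+x. of_nat N * indicator E x \<partial>M)"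
    by (subst nn_integral_cmult_indicator) (auto simp: emeasure_eq_measure ennreal_mult ennreal_of_nat_eq_real_of_nat)
  also have "\<dots> \<le> (\<integral>\<^sup>+x. indicator E x * (\<Sum>j<height E x. 1) \<partial>M)"
    using AE_good[OF E pos]
    by (intro nn_integral_mono_AE, eventually_elim)
       (use height_ge sep in \<open>auto split: split_indicator\<close>)
  also have "\<dots> = (\<integral>\<^sup>+x. 1 \<partial>M)" by (rule kac[OF E pos, symmetric]) auto
  also have "\<dots> = ennreal 1" by (simp add: emeasure_space_1)
  finally show ?thesis by (subst (asm) ennreal_le_iff) auto
qed

text \<open>A level set of \<open>U\<close> has at most one point. If it had positive measure, a
  base of positive measure inside it would be all of it, and \<open>prob_base\<close> bounds that
  measure by \<open>1 / N\<close> for arbitrary \<open>N\<close>.\<close>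

lemma prob_U_eq: "prob {x\<in>space M. U x = c} = 0"
proof (rule ccontr)
  define D where "D = {x\<in>space M. U x = c}"
  have D [measurable]: "D \<in> sets M" unfolding D_def by measurable
  assume "prob {x\<in>space M. U x = c} \<noteq> 0"
  then have pos: "prob D > 0" by (simp add: D_def zero_less_measure_iff)
  obtain N :: nat where N: "1 < N * prob D" using reals_Archimedean3[OF pos] by blast
  obtain E where E: "E \<in> sets M" "E \<subseteq> D" "prob E > 0"
    and sep: "\<forall>x\<in>E. \<forall>j. 0 < j \<longrightarrow> j < N \<longrightarrow> (T ^^ j) x \<notin> E"
    using exists_base[OF D pos, of N] by blast
  have "x = y" if "x \<in> D" "y \<in> D" for x y using that inj_onD[OF U_inj, of x y] by (auto simp: D_def)
  moreover have "E \<noteq> {}" using E by auto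
  ultimately have "E = D" using E by blast
  with prob_base[OF E(1,3), of N] sep N show False by auto
qed

text \<open>On each class of \<open>c\<close> of positive measure the distribution function of
  \<open>U\<close> is continuous, so cutting at a suitable \<open>u k\<close> retains the proportion
  \<open>t\<close> exactly. Independence is stated for integrals because it will be applied to
  functions that count levels of a column rather than to events.\<close>

lemma exists_independent_set:
  fixes c :: "'x \<Rightarrow> 'c::countable"
  assumes c [measurable]: "c \<in> measurable M (count_space UNIV)" and t: "0 < t" "t < 1"
  shows "\<exists>Z\<in>sets M. \<forall>F :: 'c \<Rightarrow> ennreal.
    (\<integral>\<^sup>+x. indicator Z x * F (c x) \<partial>M) = ennreal t * (\<integral>\<^sup>+x. F (c x) \<partial>M)"
proof -
  have "\<exists>u. prob {x\<in>space M. c x = k \<and> U x \<le> u} = t * prob {x\<in>space M. c x = k}" for k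
  proof (cases "prob {x\<in>space M. c x = k} = 0")
    case True
    have "prob {x\<in>space M. c x = k \<and> U x \<le> 0} \<le> prob {x\<in>space M. c x = k}"
      by (intro finite_measure_mono) auto
    then show ?thesis using True measure_nonneg[of M "{x\<in>space M. c x = k \<and> U x \<le> 0}"] by (intro exI[of _ 0]) auto
  next
    case False
    define K where "K = {x\<in>space M. c x = k}"
    have K [measurable]: "K \<in> sets M" unfolding K_def by measurable
    have pK: "prob K > 0" using False by (simp add: K_def zero_less_measure_iff)
    define \<nu> where "\<nu> = distr (density M (indicator K)) borel U"
    have mB: "emeasure \<nu> B = prob (K \<inter> (U -` B \<inter> space M))" if "B \<in> sets borel" for B
    proof -
      have [measurable]: "U -` B \<inter> space M \<in> sets M" using that by measurable
      have "emeasure \<nu> B = (\<integral>\<^sup>+x. indicator K x * indicator (U -` B \<inter> space M) x \<partial>M)"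
        unfolding \<nu>_def using that by (subst emeasure_distr, simp, simp, subst emeasure_density) auto
      also have "\<dots> = (\<integral>\<^sup>+x. indicator (K \<inter> (U -` B \<inter> space M)) x \<partial>M)"
        by (intro nn_integral_cong) (auto split: split_indicator)
      also have "\<dots> = emeasure M (K \<inter> (U -` B \<inter> space M))" by (subst nn_integral_indicator) auto
      finally show ?thesis by (simp add: emeasure_eq_measure)
    qed
    have m: "measure \<nu> B = prob (K \<inter> (U -` B \<inter> space M))" if "B \<in> sets borel" for B
      using mB[OF that] by (simp add: measure_def)
    interpret \<nu>: finite_borel_measure \<nu>
    proof (intro finite_borel_measure.intro finite_measureI finite_borel_measure_axioms.intro)
      have "space \<nu> = UNIV" by (simp add: \<nu>_def)
      then show "emeasure \<nu> (space \<nu>) \<noteq> \<infinity>" using mB[of UNIV] by simp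
    qed (simp add: \<nu>_def)
    have Kc: "cdf \<nu> u = prob {x\<in>space M. c x = k \<and> U x \<le> u}" for u
      unfolding cdf_def by (subst m) (auto simp: K_def intro!: arg_cong[of _ _ prob])
    have tot: "measure \<nu> (space \<nu>) = prob K"
      by (subst m) (auto simp: \<nu>_def intro!: arg_cong[of _ _ prob] dest: sets.sets_into_space[OF K, THEN subsetD])
    have cont: "isCont (cdf \<nu>) u" for u
    proof -
      have "prob (K \<inter> (U -` {u} \<inter> space M)) \<le> prob {x\<in>space M. U x = u}"
        by (intro finite_measure_mono) auto
      then show ?thesis unfolding \<nu>.isCont_cdf using prob_U_eq[of u] m[of "{u}"]
        by (simp add: measure_le_0_iff)
    qed
    have "eventually (\<lambda>u. cdf \<nu> u < t * prob K) at_bot"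
      by (rule order_tendstoD(2)[OF \<nu>.cdf_lim_at_bot]) (use t pK in simp)
    then obtain a where a: "cdf \<nu> a < t * prob K" by (auto simp: eventually_at_bot_linorder)
    have "eventually (\<lambda>u. t * prob K < cdf \<nu> u) at_top"
      by (rule order_tendstoD(1)[OF \<nu>.cdf_lim_at_top]) (use t pK tot in simp)
    then obtain b where b: "\<And>u. b \<le> u \<Longrightarrow> t * prob K < cdf \<nu> u" by (auto simp: eventually_at_top_linorder)
    have "\<exists>u. a \<le> u \<and> u \<le> max a b \<and> cdf \<nu> u = t * prob K"
      using a b[of "max a b"] cont by (intro IVT) auto
    then show ?thesis unfolding Kc K_def by blast
  qed
  then have "\<exists>u. \<forall>k. prob {x\<in>space M. c x = k \<and> U x \<le> u k} = t * prob {x\<in>space M. c x = k}"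
    by (intro choice allI)
  then obtain u where u: "\<And>k. prob {x\<in>space M. c x = k \<and> U x \<le> u k} = t * prob {x\<in>space M. c x = k}"
    by (elim exE) blast
  define Z where "Z = {x\<in>space M. U x \<le> u (c x)}"
  have Z [measurable]: "Z \<in> sets M" unfolding Z_def by measurable
  have eq: "distr (density M (indicator Z)) (count_space UNIV) c
      = scale_measure (ennreal t) (distr M (count_space UNIV) c)" (is "?L = ?R")
  proof (rule measure_eqI_countable[of _ UNIV])
    fix k
    have "emeasure ?L {k} = emeasure M {x\<in>space M. c x = k \<and> U x \<le> u k}"
      by (subst emeasure_distr, simp, simp, subst emeasure_density)
         (auto simp: Z_def nn_integral_indicator[symmetric] simp del: nn_integral_indicator
           intro!: nn_integral_cong split: split_indicator)
    also have "\<dots> = ennreal t * emeasure M {x\<in>space M. c x = k}"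
      using t by (simp add: emeasure_eq_measure u ennreal_mult)
    also have "\<dots> = emeasure ?R {k}"
      by (simp add: emeasure_distr vimage_def Int_def conj_commute)
    finally show "emeasure ?L {k} = emeasure ?R {k}" .
  qed auto
  have "(\<integral>\<^sup>+x. indicator Z x * F (c x) \<partial>M) = ennreal t * (\<integral>\<^sup>+x. F (c x) \<partial>M)" for F :: "'c \<Rightarrow> ennreal"
  proof -
    have "(\<integral>\<^sup>+x. indicator Z x * F (c x) \<partial>M) = (\<integral>\<^sup>+k. F k \<partial>?L)"
      by (subst nn_integral_distr) (auto simp: nn_integral_density)
    also have "\<dots> = ennreal t * (\<integral>\<^sup>+k. F k \<partial>distr M (count_space UNIV) c)"
      unfolding eq by (rule nn_integral_scale_measure) simp
    finally show ?thesis by (subst (asm) nn_integral_distr) auto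
  qed
  then show ?thesis using Z by (intro bexI[of _ Z] allI)
qed

end

subsection \<open>Mixing columns\<close>

lemma measurable_map_upt:
  fixes F :: "nat \<Rightarrow> 'x \<Rightarrow> 'c::countable"
  assumes [measurable]: "\<And>i. F i \<in> measurable M (count_space UNIV)"
  shows "(\<lambda>x. map (\<lambda>i. F i x) [0..<n]) \<in> measurable M (count_space UNIV)"
proof (subst measurable_count_space_eq_countable, rule countableI_type, intro conjI ballI)
  fix l :: "'c list"
  have "map (\<lambda>i. F i x) [0..<n] = l \<longleftrightarrow> length l = n \<and> (\<forall>i<n. F i x = l ! i)" for x
    unfolding list_eq_iff_nth_eq[of _ l] by auto
  then have "(\<lambda>x. map (\<lambda>i. F i x) [0..<n]) -` {l} \<inter> space M
      = {x\<in>space M. length l = n \<and> (\<forall>i<n. F i x = l ! i)}"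
    by blast
  also have "\<dots> \<in> sets M" by measurable
  finally show "(\<lambda>x. map (\<lambda>i. F i x) [0..<n]) -` {l} \<inter> space M \<in> sets M" .
qed simp

context aperiodic_system
begin

definition window :: "('x \<Rightarrow> 'b) \<Rightarrow> nat \<Rightarrow> 'x \<Rightarrow> 'b list" where
  "window f d x = map (\<lambda>m. f ((T ^^ m) x)) [0..<d]"

lemma window_meas [measurable]:
  fixes f :: "'x \<Rightarrow> 'b::countable"
  assumes [measurable]: "f \<in> measurable M (count_space UNIV)"
  shows "window f d \<in> measurable M (count_space UNIV)"
  unfolding window_def[abs_def] by (rule measurable_map_upt) measurable

lemma column_name_meas:
  fixes c :: "'x \<Rightarrow> 'b::countable"
  assumes [measurable]: "E \<in> sets M" "c \<in> measurable M (count_space UNIV)"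
  shows "(\<lambda>x. window c (height E x) x) \<in> measurable M (count_space UNIV)"
  by (rule measurable_compose_countable) measurable

text \<open>\<open>exists_independent_set\<close> is applied to the full name of the column, which
  determines at how many levels \<open>P\<close> holds. Kac's formula then carries the independence
  from the base points to all points of the columns.\<close>

lemma exists_independent_columns:
  fixes c :: "'x \<Rightarrow> 'c::countable"
  assumes E [measurable]: "E \<in> sets M" and pos: "prob E > 0"
    and c [measurable]: "c \<in> measurable M (count_space UNIV)" and t: "0 < t" "t < 1"
  shows "\<exists>Z\<in>sets M. \<forall>P. prob {x\<in>space M. base E x \<in> Z \<and> P (c x)} = t * prob {x\<in>space M. P (c x)}"
proof -
  define c' where "c' x = (x \<in> E, window c (height E x) x)" for x
  have [measurable]: "(\<lambda>x. window c (height E x) x) \<in> measurable M (count_space UNIV)"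
    by (rule column_name_meas) measurable
  have "(\<lambda>x. (x \<in> E, window c (height E x) x)) \<in> measurable M (count_space UNIV)"
    by (rule measurable_compose_countable[of "\<lambda>l x. (x \<in> E, l)"], rule measurable_compose_countable[of "\<lambda>b x. (b, _)"]) measurable
  then have c'_meas: "c' \<in> measurable M (count_space UNIV)" by (simp add: c'_def[abs_def])
  obtain Z where Z [measurable]: "Z \<in> sets M"
    and ind: "\<forall>F :: bool \<times> 'c list \<Rightarrow> ennreal.
      (\<integral>\<^sup>+x. indicator Z x * F (c' x) \<partial>M) = ennreal t * (\<integral>\<^sup>+x. F (c' x) \<partial>M)"
    using exists_independent_set[OF c'_meas t] by (elim bexE)
  have "prob {x\<in>space M. base E x \<in> Z \<and> P (c x)} = t * prob {x\<in>space M. P (c x)}" for P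
  proof -
    define F :: "bool \<times> 'c list \<Rightarrow> ennreal"
      where "F = (\<lambda>(e, l). indicator {True} e * (\<Sum>j<length l. indicator {k. P k} (l ! j)))"
    let ?B = "{x\<in>space M. base E x \<in> Z \<and> P (c x)}" and ?C = "{x\<in>space M. P (c x)}"
    have [measurable]: "?B \<in> sets M" "?C \<in> sets M" by measurable
    have Fc: "F (c' x) = indicator E x * (\<Sum>j<height E x. indicator ?C ((T ^^ j) x))" if "x \<in> space M" for x
      unfolding F_def c'_def prod.case using that
      by (intro arg_cong2[where f="(*)"] sum.cong) (auto simp: window_def split: split_indicator)
    have "emeasure M ?B = (\<integral>\<^sup>+x. indicator E x * (\<Sum>j<height E x. indicator ?B ((T ^^ j) x)) \<partial>M)"
      by (subst kac[OF E pos, symmetric]) auto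
    also have "\<dots> = (\<integral>\<^sup>+x. indicator Z x * F (c' x) \<partial>M)"
    proof (rule nn_integral_cong_AE)
      show "AE x in M. indicator E x * (\<Sum>j<height E x. indicator ?B ((T ^^ j) x)) = indicator Z x * F (c' x)"
        using AE_good[OF E pos]
      proof eventually_elim
        case (elim x)
        then have x: "x \<in> space M" by (simp add: good_def)
        show ?case
        proof (cases "x \<in> E")
          case True
          have "(indicator ?B ((T ^^ j) x) :: ennreal) = indicator Z x * indicator ?C ((T ^^ j) x)" if "j < height E x" for j
            using level_base[OF elim True that] x by (auto split: split_indicator)
          then show ?thesis unfolding Fc[OF x] using True by (simp add: sum_distrib_left)
        qed (simp add: Fc x)
      qed
    qed
    also have "\<dots> = ennreal t * (\<integral>\<^sup>+x. F (c' x) \<partial>M)" using ind by blast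
    also have "(\<integral>\<^sup>+x. F (c' x) \<partial>M) = (\<integral>\<^sup>+x. indicator E x * (\<Sum>j<height E x. indicator ?C ((T ^^ j) x)) \<partial>M)"
      by (rule nn_integral_cong) (rule Fc)
    also have "\<dots> = emeasure M ?C" by (subst kac[OF E pos, symmetric]) auto
    finally have "ennreal (prob ?B) = ennreal (t * prob ?C)"
      using t by (simp add: emeasure_eq_measure ennreal_mult)
    then show ?thesis using t by (subst (asm) ennreal_inj) auto
  qed
  then show ?thesis using Z by (intro bexI[of _ Z] allI)
qed

text \<open>Kac's formula is about nonnegative functions, and the common bound makes them
  integrable. A loss of \<open>B\<close> in each column is paid once per base point, hence
  \<open>B * prob E\<close> in total.\<close>

lemma kac_le:
  fixes u v :: "'x \<Rightarrow> real"
  assumes E [measurable]: "E \<in> sets M" and pos: "prob E > 0"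
    and [measurable]: "u \<in> borel_measurable M" "v \<in> borel_measurable M"
    and u: "\<And>x. x \<in> space M \<Longrightarrow> 0 \<le> u x" "\<And>x. x \<in> space M \<Longrightarrow> u x \<le> K"
    and v: "\<And>x. x \<in> space M \<Longrightarrow> 0 \<le> v x" "\<And>x. x \<in> space M \<Longrightarrow> v x \<le> K" and "0 \<le> B"
    and le: "\<And>x. good E x \<Longrightarrow> x \<in> E \<Longrightarrow> (\<Sum>j<height E x. v ((T ^^ j) x)) \<le> (\<Sum>j<height E x. u ((T ^^ j) x)) + B"
  shows "expectation v \<le> expectation u + B * prob E"
proof -
  have int: "integrable M u" "integrable M v"
    using u v by (auto intro!: integrable_const_bound[where B=K])
  have "ennreal (expectation v) = (\<integral>\<^sup>+x. indicator E x * (\<Sum>j<height E x. ennreal (v ((T ^^ j) x))) \<partial>M)"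
    using v int by (subst nn_integral_eq_integral[symmetric]) (auto intro!: kac E pos)
  also have "\<dots> \<le> (\<integral>\<^sup>+x. indicator E x * (\<Sum>j<height E x. ennreal (u ((T ^^ j) x))) + ennreal B * indicator E x \<partial>M)"
  proof (rule nn_integral_mono_AE)
    show "AE x in M. indicator E x * (\<Sum>j<height E x. ennreal (v ((T ^^ j) x)))
      \<le> indicator E x * (\<Sum>j<height E x. ennreal (u ((T ^^ j) x))) + ennreal B * indicator E x"
      using AE_good[OF E pos]
    proof eventually_elim
      case (elim x)
      then have "\<And>j. (T ^^ j) x \<in> space M" by (simp add: good_def)
      then show ?case using le[OF elim] u v \<open>0 \<le> B\<close>
        by (auto simp: sum_ennreal sum_nonneg ennreal_plus[symmetric] intro!: ennreal_leI
            simp del: ennreal_plus split: split_indicator)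
    qed
  qed
  also have "\<dots> = (\<integral>\<^sup>+x. indicator E x * (\<Sum>j<height E x. ennreal (u ((T ^^ j) x))) \<partial>M) + ennreal B * emeasure M E"
  proof (subst nn_integral_add)
    have "(\<lambda>x. \<Sum>j<height E x. ennreal (u ((T ^^ j) x))) \<in> borel_measurable M"
      by (rule measurable_compose_countable[of "\<lambda>n x. \<Sum>j<n. ennreal (u ((T ^^ j) x))"]) measurable
    then show "(\<lambda>x. indicator E x * (\<Sum>j<height E x. ennreal (u ((T ^^ j) x)))) \<in> borel_measurable M"
      by measurable
  qed (auto simp: nn_integral_cmult_indicator)
  also have "(\<integral>\<^sup>+x. indicator E x * (\<Sum>j<height E x. ennreal (u ((T ^^ j) x))) \<partial>M) = ennreal (expectation u)"
    using u int by (subst nn_integral_eq_integral[symmetric]) (auto intro!: kac[symmetric] E pos)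
  also have "ennreal (expectation u) + ennreal B * emeasure M E = ennreal (expectation u + B * prob E)"
    using u \<open>0 \<le> B\<close> by (simp add: emeasure_eq_measure ennreal_mult ennreal_plus integral_nonneg_AE)
  finally show ?thesis
    using u \<open>0 \<le> B\<close> by (subst (asm) ennreal_le_iff) (auto intro!: add_nonneg_nonneg integral_nonneg_AE)
qed

text \<open>
  The chain is decreasing so that any two paintings with a prescribed prefix after visits to some
  \<open>E N\<close> have it after visits to a common one.
\<close>

lemma exists_base_chain:
  "\<exists>E :: nat \<Rightarrow> 'x set. (\<forall>N. E N \<in> sets M \<and> prob (E N) > 0 \<and>
      (\<forall>x\<in>E N. \<forall>j. 0 < j \<longrightarrow> j < N \<longrightarrow> (T ^^ j) x \<notin> E N)) \<and> decseq E"
proof -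
  let ?P = "\<lambda>N E. E \<in> sets M \<and> prob E > 0 \<and> (\<forall>x\<in>E. \<forall>j. 0 < j \<longrightarrow> j < N \<longrightarrow> (T ^^ j) x \<notin> E)"
  have "\<exists>E. \<forall>N. ?P N (E N) \<and> E (Suc N) \<subseteq> E N"
  proof (rule dependent_nat_choice)
    show "\<exists>E. ?P 0 E" using prob_space by (intro exI[of _ "space M"]) auto
  next
    fix D N assume "?P N D"
    then show "\<exists>E. ?P (Suc N) E \<and> E \<subseteq> D" using exists_base[of D "Suc N"] by blast
  qed
  then obtain E where "\<forall>N. ?P N (E N) \<and> E (Suc N) \<subseteq> E N" by (elim exE)
  then show ?thesis by (intro exI[of _ E]) (simp add: decseq_Suc_iff)
qed

text \<open>The separation of visits determines the level at every point of \<open>E\<close>, not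
  just at almost every one; the definition of \<open>painting\<close> asks for the prefix at all
  points.\<close>

lemma level_early:
  assumes "x \<in> space M" "x \<in> E" "\<And>j. 0 < j \<Longrightarrow> j < N \<Longrightarrow> (T ^^ j) x \<notin> E" "j < N"
  shows "level E ((T ^^ j) x) = j \<and> base E ((T ^^ j) x) = x"
proof -
  have "level E ((T ^^ j) x) = j"
    unfolding level_def
  proof (rule Least_equality)
    show "(S ^^ j) ((T ^^ j) x) \<in> E" using assms S_Tn[of x j j] by simp
  next
    fix i assume i: "(S ^^ i) ((T ^^ j) x) \<in> E"
    show "j \<le> i"
    proof (rule ccontr)
      assume "\<not> j \<le> i"
      then have "(T ^^ (j - i)) x \<in> E" using S_Tn[of x i j] i assms(1) by simp
      then show False using assms(3)[of "j - i"] assms(4) \<open>\<not> j \<le> i\<close> by simp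
    qed
  qed
  then show ?thesis using assms S_Tn[of x j j] by (simp add: base_def)
qed

lemma base_decomp:
  assumes "good E x"
  shows "base E x \<in> E" "good E (base E x)" "(T ^^ level E x) (base E x) = x" "level E x < height E (base E x)"
proof -
  have x: "x \<in> space M" using assms by (simp add: good_def)
  have ex: "\<exists>n. (S ^^ n) x \<in> E" using assms by (auto simp: good_def INFM_nat_le)
  show b: "base E x \<in> E" unfolding base_def level_def using LeastI_ex[OF ex] .
  show ret: "(T ^^ level E x) (base E x) = x"
    using T_Sn[of x "level E x" "level E x"] x by (simp add: base_def)
  show g: "good E (base E x)"
  proof -
    have bs: "base E x \<in> space M" using x by (simp add: base_def)
    have "\<exists>\<^sub>\<infinity>j. (T ^^ j) (base E x) \<in> E"
      unfolding INFM_nat_le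
    proof
      fix m
      obtain j where "j \<ge> m" "(T ^^ j) x \<in> E" using assms by (auto simp: good_def INFM_nat_le)
      then have "(T ^^ (j + level E x)) (base E x) \<in> E" by (simp add: funpow_add ret)
      then show "\<exists>n\<ge>m. (T ^^ n) (base E x) \<in> E" using \<open>j \<ge> m\<close> by (meson trans_le_add1)
    qed
    moreover have "\<exists>\<^sub>\<infinity>j. (S ^^ j) (base E x) \<in> E"
      unfolding INFM_nat_le
    proof
      fix m
      obtain j where j: "j \<ge> m + level E x" "(S ^^ j) x \<in> E" using assms by (auto simp: good_def INFM_nat_le)
      then have "(S ^^ (j - level E x)) (base E x) = (S ^^ j) x"
        by (simp add: base_def funpow_add[symmetric, THEN fun_cong, unfolded comp_def])
      then show "\<exists>n\<ge>m. (S ^^ n) (base E x) \<in> E" using j by (intro exI[of _ "j - level E x"]) auto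
    qed
    ultimately show ?thesis using bs by (simp add: good_def)
  qed
  show "level E x < height E (base E x)" using level_iff[OF g, of "level E x"] ret b by simp
qed

end

subsection \<open>Painting independently of a partition\<close>

locale relative_painting = aperiodic_system M T S U + letters A p
  for M :: "'x measure" and T S U and A :: "nat set" and p +
  fixes Q :: "'x \<Rightarrow> nat" and d :: nat and a :: nat and E :: "nat \<Rightarrow> 'x set"
  assumes Q_meas [measurable]: "Q \<in> measurable M (count_space UNIV)"
    and Q_finite: "finite (Q ` space M)"
    and d_pos: "1 \<le> d" and a_in: "a \<in> A"
    and E_sets [measurable]: "\<And>N. E N \<in> sets M"
    and E_pos: "\<And>N. 0 < prob (E N)"
    and E_sep: "\<And>N x j. x \<in> E N \<Longrightarrow> 0 < j \<Longrightarrow> j < N \<Longrightarrow> (T ^^ j) x \<notin> E N"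
    and E_dec: "decseq E"
begin

definition painting :: "('x \<Rightarrow> nat) \<Rightarrow> bool" where
  "painting f \<longleftrightarrow> f \<in> measurable M (count_space UNIV) \<and> (\<forall>x\<in>space M. f x \<in> A) \<and>
    (\<exists>N. \<forall>x\<in>E N. \<forall>j<d. f ((T ^^ j) x) = a)"

definition joint :: "('x \<Rightarrow> nat) \<Rightarrow> nat \<times> nat list \<Rightarrow> real" where
  "joint f = (\<lambda>(q, l). prob {x\<in>space M. Q x = q \<and> window f d x = l})"

definition target :: "nat \<times> nat list \<Rightarrow> real" where
  "target = (\<lambda>(q, l). prob {x\<in>space M. Q x = q} * prod_list (map p l))"

lemma painting_const: "painting (\<lambda>_. a)"
  using a_in by (auto simp: painting_def)

lemma E_space: "x \<in> E N \<Longrightarrow> x \<in> space M"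
  using sets.sets_into_space[OF E_sets] by blast

lemma painting_mix:
  assumes f: "painting f" and g: "painting g" and t: "0 < t" "t < 1"
  shows "\<exists>h. painting h \<and> joint h = (\<lambda>i. t * joint f i + (1 - t) * joint g i)"
proof -
  have [measurable]: "f \<in> measurable M (count_space UNIV)" "g \<in> measurable M (count_space UNIV)"
    using f g by (auto simp: painting_def)
  obtain N1 N2 where N1: "\<forall>x\<in>E N1. \<forall>j<d. f ((T ^^ j) x) = a" and N2: "\<forall>x\<in>E N2. \<forall>j<d. g ((T ^^ j) x) = a"
    using f g by (auto simp: painting_def)
  define N where "N = max N1 N2"
  define B where "B = E N"
  have "B \<subseteq> E N1" "B \<subseteq> E N2" using E_dec by (auto simp: B_def N_def decseq_def)
  with N1 N2 have pre: "f ((T ^^ j) x) = a" "g ((T ^^ j) x) = a" if "x \<in> B" "j < d" for x j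
    using that by blast+
  have B [measurable]: "B \<in> sets M" and B_pos: "prob B > 0" using E_pos by (auto simp: B_def)
  \<comment> \<open>The columns are selected independently of \<open>Q\<close> and both windows at
    once, so that the two laws are scaled by the same \<open>t\<close>.\<close>
  define c where "c x = (Q x, window f d x, window g d x)" for x
  have "(\<lambda>x. (Q x, window f d x, window g d x)) \<in> measurable M (count_space UNIV)"
    by (rule measurable_compose_countable[of "\<lambda>q x. (q, _ x)"],
        rule measurable_compose_countable[of "\<lambda>l x. (_, l, _ x)"],
        rule measurable_compose_countable[of "\<lambda>l x. (_, _, l)"]) measurable
  then have c: "c \<in> measurable M (count_space UNIV)" by (simp add: c_def[abs_def])
  obtain Z where Z [measurable]: "Z \<in> sets M"
    and ind: "\<forall>P. prob {x\<in>space M. base B x \<in> Z \<and> P (c x)} = t * prob {x\<in>space M. P (c x)}"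
    using exists_independent_columns[OF B B_pos c t] by (elim bexE)
  define h where "h x = (if base B x \<in> Z then f x else g x)" for x
  have [measurable]: "h \<in> measurable M (count_space UNIV)" unfolding h_def[abs_def] by measurable
  have pre_h: "h ((T ^^ j) x) = a" if "x \<in> B" "j < d" for x j using pre[OF that] by (simp add: h_def)
  have "painting h"
    unfolding painting_def
  proof (intro conjI ballI exI[of _ N] allI impI)
    show "h x \<in> A" if "x \<in> space M" for x using f g that by (simp add: h_def painting_def)
    show "h ((T ^^ j) x) = a" if "x \<in> E N" "j < d" for x j using pre_h that by (simp add: B_def)
  qed simp
  have win: "window h d x = (if base B x \<in> Z then window f d x else window g d x)" if x: "good B x" for x
  proof -
    define e where "e = base B x"
    define n where "n = level B x"
    have e: "e \<in> B" "good B e" "(T ^^ n) e = x" "n < height B e"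
      using base_decomp[OF x] by (auto simp: e_def n_def)
    have "h ((T ^^ m) x) = (if e \<in> Z then f ((T ^^ m) x) else g ((T ^^ m) x))" if "m < d" for m
    proof (cases "m + n < height B e")
      case True
      then have "base B ((T ^^ (m + n)) e) = e" using level_base[OF e(2,1)] by blast
      then show ?thesis by (simp add: funpow_add e h_def)
    next
      \<comment> \<open>A place beyond the top is fewer than \<open>d\<close> steps after a visit,
        so both paintings show \<open>a\<close> there and the choice made for the next column is
        invisible. This also covers a window that crosses several short columns.\<close>
      case False
      define k where "k = m + n - height B e"
      have k: "k < d" "m + n = k + height B e" using False that e(4) by (auto simp: k_def)
      have "(T ^^ m) x = (T ^^ (m + n)) e" by (simp add: funpow_add e)
      also have "\<dots> = (T ^^ k) ((T ^^ height B e) e)" by (simp add: k funpow_add)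
      finally show ?thesis using pre_h pre T_height[OF e(2)] k(1) by simp
    qed
    then show ?thesis unfolding window_def e_def by auto
  qed
  have "joint h i = t * joint f i + (1 - t) * joint g i" for i
  proof (cases i)
    case (Pair q l)
    let ?F = "\<lambda>(q', w, w'). q' = q \<and> w = l" and ?G = "\<lambda>(q', w, w'). q' = q \<and> w' = l"
    let ?FZ = "{x\<in>space M. base B x \<in> Z \<and> ?F (c x)}"
    let ?GZ = "{x\<in>space M. base B x \<in> Z \<and> ?G (c x)}" and ?G' = "{x\<in>space M. ?G (c x)}"
    have ms: "?FZ \<in> sets M" "?GZ \<in> sets M" "?G' \<in> sets M" unfolding c_def prod.case by measurable
    \<comment> \<open>The columns outside \<open>Z\<close> are treated as a complement, which yields
      the factor \<open>1 - t\<close>.\<close>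
    have "prob {x\<in>space M. Q x = q \<and> window h d x = l} = prob (?FZ \<union> (?G' - ?GZ))"
    proof (rule measure_eq_AE)
      show "AE x in M. x \<in> {x\<in>space M. Q x = q \<and> window h d x = l} \<longleftrightarrow> x \<in> ?FZ \<union> (?G' - ?GZ)"
        using AE_good[OF B B_pos] AE_space by eventually_elim (auto simp: win c_def)
    qed (use ms in measurable)
    also have "\<dots> = prob ?FZ + prob (?G' - ?GZ)"
      using ms by (intro finite_measure_Union) auto
    also have "prob (?G' - ?GZ) = prob ?G' - prob ?GZ"
      using ms by (intro finite_measure_Diff) auto
    also have "prob ?FZ = t * prob {x\<in>space M. ?F (c x)}" using ind by blast
    also have "prob ?GZ = t * prob ?G'" using ind by blast
    finally show ?thesis by (simp add: Pair joint_def c_def algebra_simps)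
  qed
  then show ?thesis using \<open>painting h\<close> by (intro exI[of _ h]) auto
qed

section \<open>Centred values of windows and compensation of a loss\<close>

abbreviation index :: "(nat \<times> nat list) set" where
  "index \<equiv> Q ` space M \<times> words d"

lemma window_in_words: "(\<And>x. x \<in> space M \<Longrightarrow> f x \<in> A) \<Longrightarrow> x \<in> space M \<Longrightarrow> window f d x \<in> words d"
  by (auto simp: window_def words_def)

lemma finite_index: "finite index"
  using Q_finite finite_words by simp

text \<open>For \<open>l'\<close> in \<open>words d\<close> this is \<open>\<kappa> (q, l')\<close>
  minus its mean under the i.i.d. law. It turns the functional \<open>\<kappa>\<close> of
  \<open>joint f - target\<close> into an expectation over the system, see
  \<open>expectation_\<phi>\<close>.\<close>

definition \<phi> :: "(nat \<times> nat list \<Rightarrow> real) \<Rightarrow> nat \<Rightarrow> nat list \<Rightarrow> real" where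
  "\<phi> \<kappa> q l' = (\<Sum>l\<in>words d. \<kappa> (q, l) * ((if l' = l then 1 else 0) - prod_list (map p l)))"

lemma avg_\<phi>: "avg d (\<phi> \<kappa> q) = 0"
proof -
  have "avg d (\<phi> \<kappa> q) = (\<Sum>l\<in>words d. \<kappa> (q, l) * (avg d (\<lambda>l'. if l' = l then 1 else 0) - prod_list (map p l)))"
    unfolding \<phi>_def using finite_words by (simp add: avg_sum avg_cmult avg_diff)
  also have "\<dots> = 0"
  proof (intro sum.neutral ballI)
    fix l assume "l \<in> words d"
    then have "avg d (\<lambda>l'. if l' = l then 1 else 0) = prod_list (map p l)"
      unfolding avg_eq_sum using finite_words by (simp add: if_distrib[of "(*) _"] cong: if_cong)
    then show "\<kappa> (q, l) * (avg d (\<lambda>l'. if l' = l then 1 else 0) - prod_list (map p l)) = 0" by simp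
  qed
  finally show ?thesis .
qed

lemma \<phi>_bound: "\<exists>C\<ge>0. \<forall>q\<in>Q ` space M. \<forall>l\<in>words d. \<bar>\<phi> \<kappa> q l\<bar> \<le> C"
proof (intro exI conjI ballI)
  let ?C = "\<Sum>(q, l)\<in>index. \<bar>\<phi> \<kappa> q l\<bar>"
  show "0 \<le> ?C" by (intro sum_nonneg) auto
  fix q l assume "q \<in> Q ` space M" "l \<in> words d"
  then show "\<bar>\<phi> \<kappa> q l\<bar> \<le> ?C"
    using member_le_sum[of "(q, l)" index "\<lambda>(q, l). \<bar>\<phi> \<kappa> q l\<bar>"] finite_index by auto
qed

lemma expectation_\<phi>:
  assumes f [measurable]: "f \<in> measurable M (count_space UNIV)" and fA: "\<And>x. x \<in> space M \<Longrightarrow> f x \<in> A"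
  shows "expectation (\<lambda>x. \<phi> \<kappa> (Q x) (window f d x)) = (\<Sum>i\<in>index. \<kappa> i * (joint f i - target i))"
proof -
  define W where "W i = {x\<in>space M. Q x = fst i \<and> window f d x = snd i}" for i
  define V where "V i = {x\<in>space M. Q x = fst i}" for i :: "nat \<times> nat list"
  have sets [measurable]: "W i \<in> sets M" "V i \<in> sets M" for i
    unfolding W_def V_def by measurable
  have int: "integrable M (indicat_real (W i))" "integrable M (indicat_real (V i))" for i
    using sets by (auto intro!: integrable_real_indicator simp: emeasure_eq_measure)
  have exp: "expectation (indicat_real (W i)) = prob (W i)" "expectation (indicat_real (V i)) = prob (V i)" for i
    using sets by simp_all
  define t where "t i x = \<kappa> i * (indicat_real (W i) x - prod_list (map p (snd i)) * indicat_real (V i) x)" for i x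
  have t_int: "integrable M (t i)" for i
    unfolding t_def[abs_def] using int by auto
  have t_exp: "expectation (t i) = \<kappa> i * (joint f i - target i)" for i
    unfolding t_def[abs_def] using int exp
    by (simp add: joint_def target_def W_def[symmetric] V_def[symmetric] case_prod_beta algebra_simps)
  have "expectation (\<lambda>x. \<phi> \<kappa> (Q x) (window f d x)) = expectation (\<lambda>x. \<Sum>i\<in>index. t i x)"
  proof (rule Bochner_Integration.integral_cong[OF refl])
    fix x assume x: "x \<in> space M"
    have "(\<Sum>i\<in>index. t i x) = (\<Sum>q\<in>Q ` space M. \<Sum>l\<in>words d. t (q, l) x)"
      by (simp add: sum.cartesian_product)
    also have "\<dots> = (\<Sum>q\<in>{Q x}. \<Sum>l\<in>words d. t (q, l) x)"
      using x Q_finite by (intro sum.mono_neutral_right) (auto simp: t_def W_def V_def)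
    also have "\<dots> = \<phi> \<kappa> (Q x) (window f d x)"
      using x by (auto simp: \<phi>_def t_def W_def V_def intro!: sum.cong)
    finally show "\<phi> \<kappa> (Q x) (window f d x) = (\<Sum>i\<in>index. t i x)" ..
  qed
  also have "\<dots> = (\<Sum>i\<in>index. expectation (t i))"
    by (rule Bochner_Integration.integral_sum) (rule t_int)
  finally show ?thesis by (simp add: t_exp)
qed

text \<open>Above the top of a column the next one starts with its forced prefix, so the word of the
  column padded with \<open>a\<close> shows the correct windows up to the top.\<close>

definition extend :: "nat list \<Rightarrow> nat \<Rightarrow> nat" where
  "extend w i = (if i < length w then w ! i else a)"

lemma extend_in: "set w \<subseteq> A \<Longrightarrow> extend w i \<in> A"
  using a_in by (auto simp: extend_def)

text \<open>In each column the greedy word gains \<open>\<sigma>\<close> times the loss of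
  \<open>f\<close>, up to an error \<open>\<sigma> * e\<close> per level and \<open>B\<close> per
  column. After integration the gain is \<open>\<sigma> * \<delta>\<close>, and the constants keep
  each of the two errors below \<open>\<sigma> * \<delta> / 2\<close>.\<close>

lemma exists_compensating_painting:
  assumes f: "painting f" and neg: "(\<Sum>i\<in>index. \<kappa> i * (joint f i - target i)) < 0"
  shows "\<exists>g. painting g \<and> 0 < (\<Sum>i\<in>index. \<kappa> i * (joint g i - target i))"
proof -
  define \<delta> where "\<delta> = - (\<Sum>i\<in>index. \<kappa> i * (joint f i - target i))"
  have \<delta>: "\<delta> > 0" using neg by (simp add: \<delta>_def)
  have f_meas [measurable]: "f \<in> measurable M (count_space UNIV)" and fA: "\<And>x. x \<in> space M \<Longrightarrow> f x \<in> A"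
    using f by (auto simp: painting_def)
  obtain C where C0: "0 \<le> C" and C: "\<forall>q\<in>Q ` space M. \<forall>l\<in>words d. \<bar>\<phi> \<kappa> q l\<bar> \<le> C"
    using \<phi>_bound[of \<kappa>] by (elim exE conjE)
  define s where "s = Min (p ` A)"
  have A: "p ` A \<noteq> {}" "finite (p ` A)" using a_in finite_A by auto
  have s0: "s > 0" unfolding s_def using A p_pos by (subst Min_gr_iff) auto
  have s_le: "s \<le> p b" if "b \<in> A" for b unfolding s_def using A that by (intro Min_le) auto
  have "p a \<le> sum p A" using p_pos a_in finite_A by (intro member_le_sum) (auto simp: less_imp_le)
  then have s1: "s \<le> 1" using s_le[OF a_in] sum_p by simp
  obtain L0 :: nat where L0: "8 * d * C / \<delta> < L0" using reals_Archimedean2 by blast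
  define L where "L = max d L0"
  have L: "d \<le> L" "0 < L" "8 * d * C / \<delta> < L" using L0 d_pos by (auto simp: L_def)
  define e where "e = 4 * d * C / L"
  have e0: "0 \<le> e" using C0 by (simp add: e_def)
  have e: "e < \<delta> / 2" using L \<delta> by (simp add: e_def field_simps)
  define \<sigma> where "\<sigma> = s ^ L"
  have \<sigma>: "0 < \<sigma>" "\<sigma> \<le> 1" using s0 s1 by (auto simp: \<sigma>_def power_le_one)
  define B where "B = 7 * L * C"
  have B0: "0 \<le> B" using C0 by (simp add: B_def)
  obtain N0 :: nat where N0: "2 * B / (\<sigma> * \<delta>) < N0" using reals_Archimedean2 by blast
  \<comment> \<open>With \<open>N\<close> at least \<open>L\<close>, no further visit occurs while
    the prefix of length \<open>L\<close> is painted. With \<open>N\<close> above \<open>N0\<close>,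
    the loss \<open>B\<close> per column, spread over at least \<open>N\<close> levels, stays below
    \<open>\<sigma> * \<delta> / 2\<close>.\<close>
  define N where "N = Suc (max L N0)"
  have N: "L \<le> N" "0 < N" "2 * B / (\<sigma> * \<delta>) < N" using N0 by (auto simp: N_def)
  define F where "F = E N"
  have F [measurable]: "F \<in> sets M" and F_pos: "0 < prob F"
    and F_sep: "\<And>x j. x \<in> F \<Longrightarrow> 0 < j \<Longrightarrow> j < N \<Longrightarrow> (T ^^ j) x \<notin> F"
    using E_pos E_sep by (auto simp: F_def)
  have "N * prob F \<le> 1" using F_sep by (intro prob_base F F_pos)
  then have "B * (N * prob F) \<le> B" using mult_left_mono[OF _ B0, of "N * prob F" 1] by simp
  then have "B * prob F \<le> B / N" using N by (simp add: field_simps)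
  also have "\<dots> < \<sigma> * \<delta> / 2" using N \<sigma> \<delta> by (simp add: field_simps)
  finally have BF: "B * prob F < \<sigma> * \<delta> / 2" .

  define cost' where "cost' x w j = \<phi> \<kappa> (Q ((T ^^ j) x)) (map w [j..<j + d])" for x w j
  define ok where "ok x w \<longleftrightarrow> length w = height F x \<and> set w \<subseteq> A \<and> (\<forall>j<L. extend w j = a) \<and>
      (\<Sum>j<length w. cost' x (extend w) j)
        \<ge> - \<sigma> * (\<Sum>j<length w. \<phi> \<kappa> (Q ((T ^^ j) x)) (window f d ((T ^^ j) x))) - \<sigma> * e * length w - B" for x w
  have ok_meas [measurable]: "Measurable.pred M (\<lambda>x. ok x w)" for w
  proof -
    have Qj: "(\<lambda>x. Q ((T ^^ j) x)) \<in> measurable M (count_space UNIV)"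
      and fj: "(\<lambda>x. window f d ((T ^^ j) x)) \<in> measurable M (count_space UNIV)" for j by measurable
    have m1 [measurable]: "(\<lambda>x. \<phi> \<kappa> (Q ((T ^^ j) x)) l) \<in> borel_measurable M" for j l
      by (rule measurable_compose_countable[OF _ Qj]) simp
    have m2 [measurable]: "(\<lambda>x. \<phi> \<kappa> (Q ((T ^^ j) x)) (window f d ((T ^^ j) x))) \<in> borel_measurable M" for j
      by (rule measurable_compose_countable[OF _ fj]) (rule m1)
    have "(\<lambda>x. \<Sum>j<length w. cost' x (extend w) j) \<in> borel_measurable M"
      unfolding cost'_def by (rule borel_measurable_sum) (rule m1)
    moreover have "(\<lambda>x. \<Sum>j<length w. \<phi> \<kappa> (Q ((T ^^ j) x)) (window f d ((T ^^ j) x))) \<in> borel_measurable M"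
      by (rule borel_measurable_sum) (rule m2)
    ultimately show ?thesis unfolding ok_def by measurable
  qed
  have ok_ex: "\<exists>w. ok x w" if x: "x \<in> space M" for x
  proof -
    interpret cost_words A p d L "\<lambda>j. \<phi> \<kappa> (Q ((T ^^ j) x))" C s
      by unfold_locales (use d_pos L C x avg_\<phi> s0 s_le s1 C0 in auto)
    have fx: "f ((T ^^ j) x) \<in> A" for j using fA x by simp
    obtain w where w: "\<forall>j. w j \<in> A" "\<forall>j<L. w j = a" "\<forall>j\<ge>height F x. w j = a"
      and le: "(\<Sum>j<height F x. cost w j) \<ge> - (s ^ L) * (\<Sum>j<height F x. cost (\<lambda>j. f ((T ^^ j) x)) j)
        - s ^ L * (4 * d * C) * (height F x / L) - 7 * L * C"
      using greedy_column[OF a_in, of "\<lambda>j. f ((T ^^ j) x)" "height F x", OF fx] by (elim exE conjE)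
    have ext: "extend (map w [0..<height F x]) = w" using w by (auto simp: extend_def)
    have "cost (\<lambda>j. f ((T ^^ j) x)) j = \<phi> \<kappa> (Q ((T ^^ j) x)) (window f d ((T ^^ j) x))" for j
    proof -
      have "map (\<lambda>j. f ((T ^^ j) x)) [j..<j + d] = window f d ((T ^^ j) x)"
        by (rule nth_equalityI) (auto simp: window_def funpow_add add.commute[of j])
      then show ?thesis by (simp add: cost_def)
    qed
    moreover have "s ^ L * (4 * d * C) * (height F x / L) = \<sigma> * e * height F x"
      by (simp add: \<sigma>_def e_def)
    ultimately have "ok x (map w [0..<height F x])"
      using w le unfolding ok_def cost'_def ext by (auto simp: cost_def \<sigma>_def B_def)
    then show ?thesis by blast
  qed
  \<comment> \<open>There are only countably many words, and \<open>ok x w\<close> is measurable in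
    \<open>x\<close> for each \<open>w\<close>; taking the first admissible word gives a measurable
    choice.\<close>
  define word :: "'x \<Rightarrow> nat list" where "word x = from_nat (LEAST k. ok x (from_nat k))" for x
  have word_ok: "ok x (word x)" if "x \<in> space M" for x
  proof -
    obtain w where "ok x w" using ok_ex \<open>x \<in> space M\<close> by blast
    then have "ok x (from_nat (to_nat w))" by simp
    then show ?thesis unfolding word_def by (rule LeastI)
  qed
  have [measurable]: "(\<lambda>x. LEAST k. ok x (from_nat k)) \<in> measurable M (count_space UNIV)"
    by measurable
  have word_meas [measurable]: "word \<in> measurable M (count_space UNIV)"
    unfolding word_def[abs_def] by (rule measurable_compose[where N="count_space UNIV"]) measurable
  define g where "g x = extend (word (base F x)) (level F x)" for x
  have g_meas [measurable]: "g \<in> measurable M (count_space UNIV)"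
    unfolding g_def[abs_def]
    by (rule measurable_compose_countable[of "\<lambda>w x. extend w (level F x)"],
        rule measurable_compose_countable[of "\<lambda>n x. extend _ n"]) measurable
  have base_space: "base F x \<in> space M" if "x \<in> space M" for x
    using that by (simp add: base_def)
  have gA: "g x \<in> A" if "x \<in> space M" for x
    using word_ok[OF base_space[OF that]] unfolding g_def ok_def by (intro extend_in) auto
  have g_pre: "g ((T ^^ j) x) = a" if "x \<in> F" "j < L" for x j
  proof -
    have x: "x \<in> space M" using that E_space F_def by blast
    have "level F ((T ^^ j) x) = j \<and> base F ((T ^^ j) x) = x"
      using x that F_sep N by (intro level_early[where N=N]) auto
    then show ?thesis using word_ok[OF x] that by (simp add: g_def ok_def)
  qed
  have "painting g" unfolding painting_def
  proof (intro conjI ballI exI[of _ N] allI impI)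
    show "g ((T ^^ j) x) = a" if "x \<in> E N" "j < d" for x j using g_pre[of x j] that L by (simp add: F_def)
  qed (use gA in auto)
  define uu where "uu x = \<phi> \<kappa> (Q x) (window g d x)" for x
  define vv where "vv x = \<phi> \<kappa> (Q x) (window f d x)" for x
  have [measurable]: "(\<lambda>x. \<phi> \<kappa> (Q x) (window h d x)) \<in> borel_measurable M"
    if [measurable]: "h \<in> measurable M (count_space UNIV)" for h
    by (rule measurable_compose_countable[of "\<lambda>q x. \<phi> \<kappa> q (window h d x)"]) measurable
  then have uv_meas [measurable]: "uu \<in> borel_measurable M" "vv \<in> borel_measurable M"
    using f_meas g_meas by (auto simp: uu_def[abs_def] vv_def[abs_def])
  have uv_bound: "\<bar>uu x\<bar> \<le> C" "\<bar>vv x\<bar> \<le> C" if "x \<in> space M" for x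
    using C window_in_words[of g x] window_in_words[of f x] gA fA that by (auto simp: uu_def vv_def)
  \<comment> \<open>The shift by \<open>K\<close> makes the two functions compared below
    nonnegative, as \<open>kac_le\<close> requires.\<close>
  define K where "K = C + C + \<sigma> * e"
  have \<sigma>v: "\<bar>\<sigma> * vv x\<bar> \<le> C" if "x \<in> space M" for x
    using mult_mono[OF \<sigma>(2) uv_bound(2)[OF that]] \<sigma> by (simp add: abs_mult)
  have column: "(\<Sum>j<height F x. K - \<sigma> * vv ((T ^^ j) x) - \<sigma> * e)
      \<le> (\<Sum>j<height F x. uu ((T ^^ j) x) + K) + B" if good: "good F x" and x: "x \<in> F" for x
  proof -
    have xs: "x \<in> space M" using good by (simp add: good_def)
    \<comment> \<open>The range reaches \<open>d\<close> levels above the top, as far as windows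
      starting in the column can see.\<close>
    have gi: "g ((T ^^ i) x) = extend (word x) i" if "i < height F x + d" for i
    proof (cases "i < height F x")
      case True
      then show ?thesis using level_base[OF good x True] by (simp add: g_def)
    next
      case False
      then have "(T ^^ i) x = (T ^^ (i - height F x)) ((T ^^ height F x) x)"
        by (simp add: funpow_add[symmetric, THEN fun_cong, unfolded comp_def])
      moreover have "i - height F x < L" using that False L by auto
      moreover have "extend (word x) i = a" using word_ok[OF xs] False by (simp add: extend_def ok_def)
      ultimately show ?thesis using g_pre[OF T_height[OF good]] by simp
    qed
    have "uu ((T ^^ j) x) = cost' x (extend (word x)) j" if "j < height F x" for j
    proof -
      have "window g d ((T ^^ j) x) = map (extend (word x)) [j..<j + d]"
      proof (rule nth_equalityI)
        fix i assume "i < length (window g d ((T ^^ j) x))"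
        then have i: "i < d" by (simp add: window_def)
        then have "window g d ((T ^^ j) x) ! i = g ((T ^^ (i + j)) x)"
          by (simp add: window_def funpow_add)
        also have "\<dots> = extend (word x) (i + j)" using i that by (intro gi) simp
        finally show "window g d ((T ^^ j) x) ! i = map (extend (word x)) [j..<j + d] ! i"
          using i by (simp add: add.commute)
      qed (simp add: window_def)
      then show ?thesis by (simp add: uu_def cost'_def)
    qed
    then have "(\<Sum>j<height F x. uu ((T ^^ j) x)) = (\<Sum>j<height F x. cost' x (extend (word x)) j)"
      by simp
    moreover have "(\<Sum>j<height F x. cost' x (extend (word x)) j)
        \<ge> - \<sigma> * (\<Sum>j<height F x. vv ((T ^^ j) x)) - \<sigma> * e * height F x - B"
      using word_ok[OF xs] unfolding ok_def vv_def by auto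
    moreover have "(\<Sum>j<height F x. K - \<sigma> * vv ((T ^^ j) x) - \<sigma> * e)
        = height F x * K - \<sigma> * (\<Sum>j<height F x. vv ((T ^^ j) x)) - \<sigma> * e * height F x"
      by (simp add: sum_subtractf sum_distrib_left[symmetric])
    moreover have "(\<Sum>j<height F x. uu ((T ^^ j) x) + K) = (\<Sum>j<height F x. uu ((T ^^ j) x)) + height F x * K"
      by (simp add: sum.distrib)
    ultimately show ?thesis unfolding mult_minus_left by linarith
  qed
  have "expectation (\<lambda>x. K - \<sigma> * vv x - \<sigma> * e) \<le> expectation (\<lambda>x. uu x + K) + B * prob F"
  proof (rule kac_le[where K="K + K"])
    fix x assume x: "x \<in> space M"
    have "0 \<le> \<sigma> * e" using \<sigma> e0 by simp
    then show "0 \<le> uu x + K" "uu x + K \<le> K + K" "0 \<le> K - \<sigma> * vv x - \<sigma> * e" "K - \<sigma> * vv x - \<sigma> * e \<le> K + K"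
      using uv_bound[OF x] \<sigma>v[OF x] C0 unfolding K_def abs_le_iff by linarith+
  qed (use column F_pos B0 in auto)
  moreover have "integrable M uu" "integrable M vv"
    using uv_bound by (auto intro!: integrable_const_bound[where B=C])
  ultimately have "K - \<sigma> * expectation vv - \<sigma> * e \<le> expectation uu + K + B * prob F"
    by (simp add: prob_space)
  moreover have "expectation vv = - \<delta>"
    unfolding vv_def \<delta>_def using expectation_\<phi>[OF f_meas fA] by simp
  moreover have "\<sigma> * e < \<sigma> * \<delta> / 2" using e \<sigma> by simp
  ultimately have "0 < expectation uu" using BF by simp
  then show ?thesis using \<open>painting g\<close> expectation_\<phi>[OF g_meas gA] unfolding uu_def by auto
qed

theorem exists_independent_painting:
  "\<exists>f. f \<in> measurable M (count_space UNIV) \<and> (\<forall>x\<in>space M. f x \<in> A) \<and>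
    (\<forall>q. \<forall>l\<in>words d. prob {x\<in>space M. Q x = q \<and> window f d x = l}
       = prob {x\<in>space M. Q x = q} * prod_list (map p l))"
proof -
  let ?V = "(\<lambda>f i. joint f i - target i) ` {f. painting f}"
  have "\<exists>v\<in>?V. \<forall>i\<in>index. v i = 0"
  proof (rule convex_common_zero[OF finite_index])
    show "?V \<noteq> {}" using painting_const by auto
  next
    fix v w t assume "v \<in> ?V" "w \<in> ?V" and t: "0 < t" "t < (1::real)"
    then obtain f g where fg: "painting f" "painting g"
      "v = (\<lambda>i. joint f i - target i)" "w = (\<lambda>i. joint g i - target i)" by auto
    obtain h where "painting h" "joint h = (\<lambda>i. t * joint f i + (1 - t) * joint g i)"
      using painting_mix[OF fg(1,2) t] by (elim exE conjE)
    then show "(\<lambda>i. t * v i + (1 - t) * w i) \<in> ?V"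
      by (intro image_eqI[of _ _ h]) (auto simp: fg algebra_simps)
  next
    fix \<kappa> v assume le: "\<And>v. v \<in> ?V \<Longrightarrow> (\<Sum>i\<in>index. \<kappa> i * v i) \<le> 0" and "v \<in> ?V"
    then obtain f where f: "painting f" "v = (\<lambda>i. joint f i - target i)" by auto
    show "(\<Sum>i\<in>index. \<kappa> i * v i) = 0"
    proof (rule ccontr)
      assume "(\<Sum>i\<in>index. \<kappa> i * v i) \<noteq> 0"
      then have neg: "(\<Sum>i\<in>index. \<kappa> i * (joint f i - target i)) < 0"
        using le[OF \<open>v \<in> ?V\<close>] by (simp add: f)
      obtain g where "painting g" "0 < (\<Sum>i\<in>index. \<kappa> i * (joint g i - target i))"
        using exists_compensating_painting[OF f(1) neg] by (elim exE conjE)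
      then show False using le[of "\<lambda>i. joint g i - target i"] by auto
    qed
  qed
  then obtain f where f: "painting f" and eq: "\<And>i. i \<in> index \<Longrightarrow> joint f i = target i" by auto
  have "prob {x\<in>space M. Q x = q \<and> window f d x = l} = prob {x\<in>space M. Q x = q} * prod_list (map p l)"
    if "l \<in> words d" for q l
  proof (cases "q \<in> Q ` space M")
    case True
    then show ?thesis using eq[of "(q, l)"] that by (simp add: joint_def target_def)
  next
    case False
    then have *: "{x\<in>space M. Q x = q \<and> window f d x = l} = {}" "{x\<in>space M. Q x = q} = {}" by auto
    show ?thesis unfolding * by simp
  qed
  then show ?thesis using f by (intro exI[of _ f]) (auto simp: painting_def)
qed

end

subsection \<open>Triangular arrays\<close>

text \<open>In base \<open>3\<close> with digits \<open>0\<close> and \<open>1\<close>, the first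
  difference at place \<open>n\<close> contributes \<open>(1/3) ^ n\<close>, while all later places
  together change at most half of that. In base \<open>2\<close> expansions would be
  ambiguous.\<close>

lemma ternary_expansion_inj:
  fixes b c :: "nat \<Rightarrow> bool"
  assumes eq: "(\<Sum>n. of_bool (b n) * (1/3) ^ n :: real) = (\<Sum>n. of_bool (c n) * (1/3) ^ n)"
  shows "b = c"
proof (rule ccontr)
  assume "b \<noteq> c"
  have geo: "summable (\<lambda>n. (1/3::real) ^ n)" by (rule summable_geometric) simp
  have sb: "summable (\<lambda>n. of_bool (b n) * (1/3) ^ n :: real)" for b :: "nat \<Rightarrow> bool"
    by (rule summable_comparison_test'[OF geo, of 0]) auto
  have st: "summable (\<lambda>n. (of_bool (b n) - of_bool (c n)) * (1/3) ^ n :: real)" for b c :: "nat \<Rightarrow> bool"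
    using summable_diff[OF sb sb, of b c] by (simp add: left_diff_distrib)
  obtain n where n: "b n \<noteq> c n" and eqn: "\<And>m. m < n \<Longrightarrow> b m = c m"
    using \<open>b \<noteq> c\<close> exists_least_iff[of "\<lambda>n. b n \<noteq> c n"] by (auto simp: fun_eq_iff)
  have False if n: "b n" "\<not> c n" and eqn: "\<And>m. m < n \<Longrightarrow> b m = c m"
    and eq: "(\<Sum>n. of_bool (b n) * (1/3) ^ n :: real) = (\<Sum>n. of_bool (c n) * (1/3) ^ n)"
    for b c :: "nat \<Rightarrow> bool"
  proof -
    let ?t = "\<lambda>n. (of_bool (b n) - of_bool (c n)) * (1/3) ^ n :: real"
    have "suminf ?t = 0"
      using suminf_diff[OF sb sb, of b c] eq by (simp add: left_diff_distrib)
    moreover have "suminf ?t = (\<Sum>k. ?t (k + Suc n)) + (\<Sum>k<Suc n. ?t k)"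
      by (rule suminf_split_initial_segment[OF st])
    moreover have "(\<Sum>k<Suc n. ?t k) = (1/3) ^ n" using n eqn by simp
    moreover have "- (\<Sum>k. ?t (k + Suc n)) \<le> (1/3) ^ n / 2"
    proof -
      have "(\<Sum>k. - ?t (k + Suc n)) \<le> (\<Sum>k. (1/3) ^ Suc n * (1/3) ^ k)"
      proof (rule suminf_le)
        show "- ?t (k + Suc n) \<le> (1/3) ^ Suc n * (1/3) ^ k" for k
          by (auto simp: power_add)
        show "summable (\<lambda>k. - ?t (k + Suc n))"
          by (intro summable_minus summable_ignore_initial_segment st)
      qed (intro summable_mult geo)
      also have "\<dots> = (1/3) ^ Suc n * (1 / (1 - 1/3))"
        by (subst suminf_mult[OF geo]) (simp add: suminf_geometric)
      also have "\<dots> = (1/3) ^ n / 2" by simp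
      finally show ?thesis
        using suminf_minus[OF summable_ignore_initial_segment[OF st, where k="Suc n"], of b c] by simp
    qed
    moreover have "(0::real) < (1/3) ^ n" by simp
    ultimately show False by linarith
  qed
  from this[of b c] this[of c b] n eqn eq show False by auto
qed

text \<open>By the Hausdorff property a point is determined by the sets of a countable base that
  contain it; these memberships are read as ternary digits. Measurability persists under
  completion.\<close>

lemma standard_prob_space_inj_real:
  fixes M :: "'x measure"
  assumes "standard_prob_space M"
  shows "\<exists>U\<in>borel_measurable M. inj_on (U :: 'x \<Rightarrow> real) (space M)"
proof -
  obtain N where N: "standard_borel N" "M = N \<or> M = completion N"
    using assms by (auto simp: standard_prob_space_def)
  obtain X where X: "completely_metrizable_space X" "second_countable X"
    and sp: "space N = topspace X" and sets: "sets N = sigma_sets (topspace X) {U. openin X U}"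
    using N(1) unfolding standard_borel_def by (elim exE conjE)
  obtain \<B> where \<B>: "countable \<B>" "\<forall>V\<in>\<B>. openin X V"
    and basis: "\<forall>U x. openin X U \<and> x \<in> U \<longrightarrow> (\<exists>V\<in>\<B>. x \<in> V \<and> V \<subseteq> U)"
    using X(2) unfolding second_countable_def by (elim exE conjE)
  \<comment> \<open>The empty set is added so that there is always something to enumerate.\<close>
  define V where "V = from_nat_into (insert {} \<B>)"
  have rV: "range V = insert {} \<B>" unfolding V_def using \<B>(1) by (intro range_from_nat_into) auto
  have V: "V n \<in> sets N" for n
  proof -
    have "V n \<in> insert {} \<B>" using rV by blast
    then have "openin X (V n)" using \<B>(2) by auto
    then show ?thesis unfolding sets by (intro sigma_sets.Basic) simp
  qed
  define U where "U x = (\<Sum>n. of_bool (x \<in> V n) * (1/3) ^ n :: real)" for x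
  have [measurable]: "Measurable.pred N (\<lambda>x. x \<in> V n)" for n using V[of n] by measurable
  have "(\<lambda>x. of_bool (x \<in> V n) :: real) \<in> borel_measurable N" for n
    unfolding of_bool_def by measurable
  then have UN: "U \<in> borel_measurable N"
    unfolding U_def[abs_def] by (intro borel_measurable_suminf borel_measurable_times) auto
  have "inj_on U (space N)"
  proof (rule inj_onI, rule ccontr)
    fix x y assume xy: "x \<in> space N" "y \<in> space N" "U x = U y" "x \<noteq> y"
    have H: "Hausdorff_space X"
      using X(1) completely_metrizable_imp_metrizable_space metrizable_imp_Hausdorff_space by blast
    then obtain O1 O2 where O: "openin X O1" "x \<in> O1" "y \<in> O2" "disjnt O1 O2"
      using xy unfolding Hausdorff_space_def sp by meson
    then obtain W where W: "W \<in> \<B>" "x \<in> W" "W \<subseteq> O1" using basis by blast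
    then have "y \<notin> W" using O by (auto simp: disjnt_def)
    moreover obtain n where "V n = W" using W(1) rV by (metis insertI2 rangeE)
    moreover have "(\<lambda>n. x \<in> V n) = (\<lambda>n. y \<in> V n)"
      using xy(3) unfolding U_def by (rule ternary_expansion_inj)
    ultimately show False using W(2) by (auto simp: fun_eq_iff)
  qed
  moreover have "U \<in> borel_measurable M" "space M = space N"
    using N(2) UN by (auto intro: measurable_completion)
  ultimately show ?thesis by auto
qed

text \<open>Letters of probability zero are discarded to obtain the strict positivity in
  \<open>letters\<close>. A word containing such a letter has weight zero and never occurs as a
  window, so the formula extends to all words of length \<open>d\<close>.\<close>

lemma (in aperiodic_system) exists_independent_process_step:
  fixes Q :: "'x \<Rightarrow> nat" and p :: "nat \<Rightarrow> real" and d :: nat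
  assumes Q: "Q \<in> measurable M (count_space UNIV)" "finite (Q ` space M)"
    and d: "1 \<le> d" and A: "finite A" and p: "\<And>a. a \<in> A \<Longrightarrow> 0 \<le> p a" "sum p A = 1" "\<And>a. a \<notin> A \<Longrightarrow> p a = 0"
  shows "\<exists>f. f \<in> measurable M (count_space UNIV) \<and> (\<forall>x\<in>space M. f x \<in> A) \<and>
    (\<forall>q l. length l = d \<longrightarrow> prob {x\<in>space M. Q x = q \<and> window f d x = l}
       = prob {x\<in>space M. Q x = q} * prod_list (map p l))"
proof -
  define A' where "A' = {a\<in>A. 0 < p a}"
  have p0: "p a = 0" if "a \<notin> A'" for a using p(1,3)[of a] that by (force simp: A'_def)
  have "sum p A' = 1"
    unfolding p(2)[symmetric] using A p0 by (intro sum.mono_neutral_left) (auto simp: A'_def)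
  moreover from this have "A' \<noteq> {}" by auto
  ultimately obtain a where a: "a \<in> A'" and sum1: "sum p A' = 1" by auto
  obtain E :: "nat \<Rightarrow> 'x set" where E: "\<forall>N. E N \<in> sets M \<and> prob (E N) > 0 \<and>
      (\<forall>x\<in>E N. \<forall>j. 0 < j \<longrightarrow> j < N \<longrightarrow> (T ^^ j) x \<notin> E N)" "decseq E"
    using exists_base_chain by (elim exE conjE)
  interpret relative_painting M T S U A' p Q d a E
    by unfold_locales (use Q d a sum1 A E in \<open>auto simp: A'_def\<close>)
  obtain f where f: "f \<in> measurable M (count_space UNIV)" "\<forall>x\<in>space M. f x \<in> A'"
    and eq: "\<forall>q. \<forall>l\<in>words d. prob {x\<in>space M. Q x = q \<and> window f d x = l}
       = prob {x\<in>space M. Q x = q} * prod_list (map p l)"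
    using exists_independent_painting by (elim exE conjE)
  have "prob {x\<in>space M. Q x = q \<and> window f d x = l} = prob {x\<in>space M. Q x = q} * prod_list (map p l)"
    if len: "length l = d" for q l
  proof (cases "l \<in> words d")
    case False
    then obtain b where "b \<in> set l" "b \<notin> A'" using len by (auto simp: words_def)
    then have "prod_list (map p l) = 0" using p0 by (force simp: prod_list_zero_iff)
    moreover have *: "{x\<in>space M. Q x = q \<and> window f d x = l} = {}"
      using False window_in_words[of f] f(2) by auto
    ultimately show ?thesis unfolding * by simp
  qed (use eq in simp)
  then show ?thesis using f by (intro exI[of _ f]) (auto simp: A'_def)
qed

text \<open>The windows of all earlier rows are coded in one natural number \<open>Q n\<close>. Its
  range stays finite, so the next row can be chosen independent of it, and the product formula
  follows by multiplying along the rows.\<close>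

lemma (in aperiodic_system) exists_independent_processes:
  fixes p :: "nat \<Rightarrow> nat \<Rightarrow> real" and d :: "nat \<Rightarrow> nat"
  assumes d: "\<And>n. 1 \<le> d n" and A: "finite A"
    and p: "\<And>n a. a \<in> A \<Longrightarrow> 0 \<le> p n a" "\<And>n. sum (p n) A = 1" "\<And>n a. a \<notin> A \<Longrightarrow> p n a = 0"
  shows "\<exists>f. (\<forall>n. f n \<in> measurable M (count_space UNIV)) \<and> (\<forall>n. \<forall>x\<in>space M. f n x \<in> A) \<and>
    (\<forall>K u. (\<forall>n. length (u n) = d n) \<longrightarrow>
      prob {x\<in>space M. \<forall>n<K. window (f n) (d n) x = u n} = (\<Prod>n<K. prod_list (map (p n) (u n))))"
proof -
  define ok where "ok n Q f \<longleftrightarrow> Q \<in> measurable M (count_space UNIV) \<and> finite (Q ` space M) \<and>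
    f \<in> measurable M (count_space UNIV) \<and> (\<forall>x\<in>space M. f x \<in> A) \<and>
    (\<forall>q l. length l = d n \<longrightarrow> prob {x\<in>space M. Q x = q \<and> window f (d n) x = l}
       = prob {x\<in>space M. Q x = q} * prod_list (map (p n) l))" for n and Q f :: "'x \<Rightarrow> nat"
  have ex: "\<exists>f. ok n Q f" if "Q \<in> measurable M (count_space UNIV)" "finite (Q ` space M)" for n Q
    using exists_independent_process_step[OF that d A p(1) p(2) p(3)] that unfolding ok_def by blast
  \<comment> \<open>The state of the recursion is the partition together with the row painted
    relative to it; the clause for \<open>n = 0\<close> fixes the trivial partition as the
    start.\<close>
  have "\<exists>F. \<forall>n. (ok n (fst (F n)) (snd (F n)) \<and> (n = 0 \<longrightarrow> fst (F n) = (\<lambda>_. 0))) \<and>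
     fst (F (Suc n)) = (\<lambda>x. to_nat (fst (F n) x, window (snd (F n)) (d n) x))"
  proof (rule dependent_nat_choice)
    have "finite ((\<lambda>_. 0 :: nat) ` space M)" by (rule finite_subset[of _ "{0}"]) auto
    then obtain f where "ok 0 (\<lambda>_. 0) f" using ex[of "\<lambda>_. 0" 0] by auto
    then show "\<exists>F. ok 0 (fst F) (snd F) \<and> (0 = (0::nat) \<longrightarrow> fst F = (\<lambda>_. 0))"
      by (intro exI[of _ "(\<lambda>_. 0, f)"]) simp
  next
    fix F n assume "ok n (fst F) (snd F) \<and> (n = 0 \<longrightarrow> fst F = (\<lambda>_. 0))"
    then have F: "ok n (fst F) (snd F)" by simp
    define Q where "Q x = to_nat (fst F x, window (snd F) (d n) x)" for x
    have [measurable]: "fst F \<in> measurable M (count_space UNIV)" "snd F \<in> measurable M (count_space UNIV)"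
      using F by (auto simp: ok_def)
    have "Q \<in> measurable M (count_space UNIV)"
      unfolding Q_def[abs_def]
      by (rule measurable_compose_countable[of "\<lambda>q x. to_nat (q, _ x)"],
          rule measurable_compose_countable[of "\<lambda>l x. to_nat (_, l)"]) measurable
    moreover have "Q ` space M \<subseteq> (\<lambda>(q, l). to_nat (q, l)) ` (fst F ` space M \<times> {l. set l \<subseteq> A \<and> length l = d n})"
      using F by (auto simp: Q_def ok_def window_def intro!: image_eqI)
    then have "finite (Q ` space M)"
      using F finite_lists_length_eq[OF A] by (elim finite_subset) (auto simp: ok_def)
    ultimately obtain f where "ok (Suc n) Q f" using ex by blast
    then show "\<exists>G. (ok (Suc n) (fst G) (snd G) \<and> (Suc n = 0 \<longrightarrow> fst G = (\<lambda>_. 0))) \<and>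
        fst G = (\<lambda>x. to_nat (fst F x, window (snd F) (d n) x))"
      by (intro exI[of _ "(Q, f)"]) (simp add: Q_def[abs_def])
  qed
  then obtain F where F: "\<forall>n. (ok n (fst (F n)) (snd (F n)) \<and> (n = 0 \<longrightarrow> fst (F n) = (\<lambda>_. 0))) \<and>
     fst (F (Suc n)) = (\<lambda>x. to_nat (fst (F n) x, window (snd (F n)) (d n) x))" by (elim exE)
  define Q f where "Q n = fst (F n)" and "f n = snd (F n)" for n
  have ok: "ok n (Q n) (f n)" and Q0: "Q 0 = (\<lambda>_. 0)"
    and QS: "Q (Suc n) = (\<lambda>x. to_nat (Q n x, window (f n) (d n) x))" for n
    using F by (auto simp: Q_def f_def)
  have "prob {x\<in>space M. \<forall>n<K. window (f n) (d n) x = u n} = (\<Prod>n<K. prod_list (map (p n) (u n)))"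
    if u: "\<forall>n. length (u n) = d n" for K u
  proof -
    have "\<exists>q. (\<forall>x. Q K x = q \<longleftrightarrow> (\<forall>n<K. window (f n) (d n) x = u n)) \<and>
        prob {x\<in>space M. Q K x = q} = (\<Prod>n<K. prod_list (map (p n) (u n)))"
    proof (induction K)
      case 0
      then show ?case by (intro exI[of _ 0]) (simp add: Q0 prob_space)
    next
      case (Suc K)
      then obtain q where q: "\<And>x. Q K x = q \<longleftrightarrow> (\<forall>n<K. window (f n) (d n) x = u n)"
        "prob {x\<in>space M. Q K x = q} = (\<Prod>n<K. prod_list (map (p n) (u n)))" by blast
      have QK: "Q (Suc K) x = to_nat (q, u K) \<longleftrightarrow> Q K x = q \<and> window (f K) (d K) x = u K" for x
        by (simp add: QS)
      have "prob {x\<in>space M. Q (Suc K) x = to_nat (q, u K)} = prob {x\<in>space M. Q K x = q} * prod_list (map (p K) (u K))"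
        unfolding QK using ok[of K] u by (simp add: ok_def)
      then show ?case using q by (intro exI[of _ "to_nat (q, u K)"]) (auto simp: QK less_Suc_eq)
    qed
    then obtain q where "\<forall>x. Q K x = q \<longleftrightarrow> (\<forall>n<K. window (f n) (d n) x = u n)"
      "prob {x\<in>space M. Q K x = q} = (\<Prod>n<K. prod_list (map (p n) (u n)))" by (elim exE conjE)
    then show ?thesis by simp
  qed
  then show ?thesis using ok by (intro exI[of _ f]) (auto simp: ok_def)
qed

section \<open>Joint laws and cylinders\<close>

lemma (in prob_space) prob_box_eq_sum:
  assumes "finite J" "finite A"
    and Y [measurable]: "\<And>j. j \<in> J \<Longrightarrow> Y j \<in> measurable M (count_space A)"
    and F: "\<And>j. j \<in> J \<Longrightarrow> F j \<subseteq> A"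
  shows "prob {x\<in>space M. \<forall>j\<in>J. Y j x \<in> F j} = (\<Sum>u\<in>PiE J F. prob {x\<in>space M. \<forall>j\<in>J. Y j x = u j})"
proof -
  have fin: "finite (PiE J F)" using assms by (intro finite_PiE) (auto intro: finite_subset)
  have sets: "{x\<in>space M. \<forall>j\<in>J. Y j x = u j} \<in> sets M" if "u \<in> PiE J F" for u
  proof -
    have "(\<lambda>x. Y j x = u j) \<in> measurable M (count_space UNIV)" if "j \<in> J" for j
      by (rule measurable_compose[OF Y[OF that]]) simp
    then show ?thesis using \<open>finite J\<close> by measurable
  qed
  have "{x\<in>space M. \<forall>j\<in>J. Y j x \<in> F j} = (\<Union>u\<in>PiE J F. {x\<in>space M. \<forall>j\<in>J. Y j x = u j})"
  proof (intro equalityI subsetI)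
    fix x assume "x \<in> {x\<in>space M. \<forall>j\<in>J. Y j x \<in> F j}"
    then show "x \<in> (\<Union>u\<in>PiE J F. {x\<in>space M. \<forall>j\<in>J. Y j x = u j})"
      by (intro UN_I[of "restrict (\<lambda>j. Y j x) J"]) auto
  qed (auto simp: PiE_def Pi_def)
  moreover have "disjoint_family_on (\<lambda>u. {x\<in>space M. \<forall>j\<in>J. Y j x = u j}) (PiE J F)"
    unfolding disjoint_family_on_def
  proof (intro ballI impI)
    fix u v assume uv: "u \<in> PiE J F" "v \<in> PiE J F" "u \<noteq> v"
    then obtain j where "j \<in> J" "u j \<noteq> v j" by (meson PiE_ext)
    then show "{x\<in>space M. \<forall>j\<in>J. Y j x = u j} \<inter> {x\<in>space M. \<forall>j\<in>J. Y j x = v j} = {}" by auto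
  qed
  ultimately show ?thesis using fin sets by (simp add: finite_measure_finite_Union image_subset_iff)
qed

lemma measurable_joint:
  assumes "\<And>n m. (n, m) \<in> array_index d \<Longrightarrow> Z n m \<in> measurable L (count_space A)"
  shows "(\<lambda>x. restrict (\<lambda>(n, m). Z n m x) (array_index d))
    \<in> measurable L (PiM (array_index d) (\<lambda>_. count_space A))"
  using assms by (intro measurable_restrict) auto

text \<open>The construction controls complete rows. A cylinder over \<open>J\<close> is therefore
  viewed over the rectangle \<open>R\<close> of the first \<open>K\<close> rows, the unrestricted
  places ranging over the finite set \<open>A\<close>, and is split into single patterns.\<close>

lemma emeasure_joint_distr_cylinder:
  fixes d :: "nat \<Rightarrow> nat" and K :: nat
  defines "R \<equiv> Sigma {1..K} (\<lambda>n. {..<d n})"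
  assumes "prob_space L" and A: "finite A"
    and Z: "\<And>n m. (n, m) \<in> array_index d \<Longrightarrow> Z n m \<in> measurable L (count_space A)"
    and J: "finite J" "J \<subseteq> R" and F: "\<And>j. j \<in> J \<Longrightarrow> F j \<subseteq> A"
  shows "emeasure (joint_distr L A d Z) (prod_emb (array_index d) (\<lambda>_. count_space A) J (PiE J F))
      = ennreal (\<Sum>u\<in>PiE R (\<lambda>j. if j \<in> J then F j else A).
          measure L {x\<in>space L. \<forall>j\<in>R. case_prod Z j x = u j})"
proof -
  let ?I = "array_index d" and ?N = "\<lambda>_. count_space A"
  have R_I: "R \<subseteq> ?I" by (auto simp: R_def array_index_def)
  interpret L: prob_space L by fact
  have ZA: "case_prod Z j x \<in> A" if "j \<in> ?I" "x \<in> space L" for j x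
    using measurable_space[OF Z, of "fst j" "snd j" x] that by (simp add: case_prod_beta)
  have "prod_emb ?I ?N J (PiE J F) \<in> sets (PiM ?I ?N)"
    using J R_I F by (intro sets_PiM_I) auto
  then have "emeasure (joint_distr L A d Z) (prod_emb ?I ?N J (PiE J F))
    = emeasure L ((\<lambda>x. restrict (\<lambda>(n, m). Z n m x) ?I) -` prod_emb ?I ?N J (PiE J F) \<inter> space L)"
    unfolding joint_distr_def by (intro emeasure_distr measurable_joint Z)
  also have "(\<lambda>x. restrict (\<lambda>(n, m). Z n m x) ?I) -` prod_emb ?I ?N J (PiE J F) \<inter> space L
    = {x\<in>space L. \<forall>j\<in>R. case_prod Z j x \<in> (if j \<in> J then F j else A)}"
  proof (intro set_eqI)
    fix x
    have "restrict (\<lambda>(n, m). Z n m x) ?I \<in> prod_emb ?I ?N J (PiE J F) \<longleftrightarrow> (\<forall>j\<in>J. case_prod Z j x \<in> F j)"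
      if "x \<in> space L"
      using J R_I ZA[OF _ that] by (auto simp: prod_emb_iff PiE_iff case_prod_beta subset_iff)
    moreover have "(\<forall>j\<in>J. case_prod Z j x \<in> F j) \<longleftrightarrow> (\<forall>j\<in>R. case_prod Z j x \<in> (if j \<in> J then F j else A))"
      if x: "x \<in> space L"
    proof (intro iffI ballI)
      fix j assume "\<forall>j\<in>J. case_prod Z j x \<in> F j" "j \<in> R"
      then show "case_prod Z j x \<in> (if j \<in> J then F j else A)" using ZA[OF _ x, of j] R_I by auto
    next
      fix j assume "\<forall>j\<in>R. case_prod Z j x \<in> (if j \<in> J then F j else A)" and j: "j \<in> J"
      then have "case_prod Z j x \<in> (if j \<in> J then F j else A)" using J(2) by (elim bspec) blast
      then show "case_prod Z j x \<in> F j" using j by simp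
    qed
    ultimately show "x \<in> (\<lambda>x. restrict (\<lambda>(n, m). Z n m x) ?I) -` prod_emb ?I ?N J (PiE J F) \<inter> space L
      \<longleftrightarrow> x \<in> {x\<in>space L. \<forall>j\<in>R. case_prod Z j x \<in> (if j \<in> J then F j else A)}"
      by blast
  qed
  also have "emeasure L \<dots> = ennreal (L.prob {x\<in>space L. \<forall>j\<in>R. case_prod Z j x \<in> (if j \<in> J then F j else A)})"
    by (rule L.emeasure_eq_measure)
  also have "L.prob {x\<in>space L. \<forall>j\<in>R. case_prod Z j x \<in> (if j \<in> J then F j else A)}
    = (\<Sum>u\<in>PiE (R) (\<lambda>j. if j \<in> J then F j else A). L.prob {x\<in>space L. \<forall>j\<in>R. case_prod Z j x = u j})"
    using A F Z R_I by (intro L.prob_box_eq_sum) (auto simp: R_def)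
  finally show ?thesis .
qed

text \<open>Finite cylinders determine a finite measure on the product, and every finite set of
  indices lies in the first \<open>K\<close> rows for some \<open>K\<close>.\<close>

lemma joint_distr_eqI:
  fixes P :: "'w measure" and M :: "'x measure" and d :: "nat \<Rightarrow> nat"
  assumes "prob_space M" "prob_space P" and A: "finite A"
    and X: "\<And>n m. (n, m) \<in> array_index d \<Longrightarrow> X n m \<in> measurable P (count_space A)"
    and Y: "\<And>n m. (n, m) \<in> array_index d \<Longrightarrow> Y n m \<in> measurable M (count_space A)"
    and eq: "\<And>K u. u \<in> PiE (Sigma {1..K} (\<lambda>n. {..<d n})) (\<lambda>_. A) \<Longrightarrow>
      measure M {x\<in>space M. \<forall>j\<in>Sigma {1..K} (\<lambda>n. {..<d n}). case_prod Y j x = u j}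
      = measure P {x\<in>space P. \<forall>j\<in>Sigma {1..K} (\<lambda>n. {..<d n}). case_prod X j x = u j}"
  shows "joint_distr M A d Y = joint_distr P A d X"
proof -
  interpret M: prob_space M by fact
  interpret P: prob_space P by fact
  let ?I = "array_index d" and ?N = "\<lambda>_. count_space A"
  define R where "R K = Sigma {1..K} (\<lambda>n. {..<d n})" for K
  show ?thesis
  proof (rule measure_eqI_PiM_infinite)
    show "sets (joint_distr M A d Y) = sets (PiM ?I ?N)" "sets (joint_distr P A d X) = sets (PiM ?I ?N)"
      by (simp_all add: joint_distr_def)
    show "finite_measure (joint_distr M A d Y)"
      using M.prob_space_distr[OF measurable_joint[of d Y, OF Y]] by (simp add: joint_distr_def prob_space.finite_measure)
  next
    fix F J assume J: "finite J" "J \<subseteq> ?I" and F: "\<And>j. j \<in> J \<Longrightarrow> F j \<in> sets (count_space A)"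
    \<comment> \<open>Inserting \<open>0\<close> makes the maximum meaningful for empty
      \<open>J\<close>.\<close>
    define K where "K = Max (insert 0 (fst ` J))"
    have JR: "J \<subseteq> R K"
    proof
      fix j assume j: "j \<in> J"
      then have "fst j \<le> K" unfolding K_def using J by (intro Max_ge) auto
      then show "j \<in> R K" using j J by (cases j) (auto simp: R_def array_index_def)
    qed
    have FA: "\<And>j. j \<in> J \<Longrightarrow> F j \<subseteq> A" using F by simp
    have "M.prob {x\<in>space M. \<forall>j\<in>R K. case_prod Y j x = u j} = P.prob {x\<in>space P. \<forall>j\<in>R K. case_prod X j x = u j}"
      if "u \<in> PiE (R K) (\<lambda>j. if j \<in> J then F j else A)" for u
    proof -
      have "u \<in> PiE (R K) (\<lambda>_. A)"
        using that FA by (auto simp: PiE_iff split: if_splits) 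
      then show ?thesis using eq[of u K] by (simp add: R_def)
    qed
    then show "emeasure (joint_distr M A d Y) (prod_emb ?I ?N J (PiE J F))
        = emeasure (joint_distr P A d X) (prod_emb ?I ?N J (PiE J F))"
      using emeasure_joint_distr_cylinder[OF \<open>prob_space M\<close> A Y J(1) JR[unfolded R_def] FA]
        emeasure_joint_distr_cylinder[OF \<open>prob_space P\<close> A X J(1) JR[unfolded R_def] FA]
      by (simp add: R_def cong: sum.cong)
  qed
qed

text \<open>Independence gives a product over all places, and identical distribution within a row
  lets place \<open>0\<close>, present in every row, stand for the others.\<close>

lemma triangular_array_prob_rectangle:
  assumes arr: "triangular_array P A d X" and d: "\<And>n. n \<ge> 1 \<Longrightarrow> d n > 0"
    and u: "u \<in> PiE (Sigma {1..K} (\<lambda>n. {..<d n})) (\<lambda>_. A)"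
  shows "measure P {x\<in>space P. \<forall>j\<in>Sigma {1..K} (\<lambda>n. {..<d n}). case_prod X j x = u j}
    = (\<Prod>n\<in>{1..K}. \<Prod>m<d n. measure P {x\<in>space P. X n 0 x = u (n, m)})"
proof -
  interpret P: prob_space P using arr by (simp add: triangular_array_def)
  let ?R = "Sigma {1..K} (\<lambda>n. {..<d n})"
  have R_I: "?R \<subseteq> array_index d" by (auto simp: array_index_def)
  have X: "\<forall>(n, m)\<in>array_index d. X n m \<in> measurable P (count_space A)"
    and same: "\<forall>n\<ge>1. \<forall>m<d n. \<forall>m'<d n. distr P (count_space A) (X n m) = distr P (count_space A) (X n m')"
    and ind: "P.indep_vars (\<lambda>_. count_space A) (\<lambda>(n, m). X n m) (array_index d)"
    using arr unfolding triangular_array_def by blast+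
  have id: "distr P (count_space A) (X n m) = distr P (count_space A) (X n 0)" if "1 \<le> n" "m < d n" for n m
    using same[rule_format, OF that d[OF that(1)]] .
  have pt: "P.prob (case_prod X j -` {u j} \<inter> space P) = P.prob {x\<in>space P. X (fst j) 0 x = u j}" if j: "j \<in> ?R" for j
  proof -
    obtain n m where nm: "j = (n, m)" "1 \<le> n" "m < d n" using j by auto
    have uA: "{u j} \<in> sets (count_space A)" using u j by auto
    have m: "X n m \<in> measurable P (count_space A)" "X n 0 \<in> measurable P (count_space A)"
      using nm d[OF nm(2)] X by (auto simp: array_index_def)
    have "P.prob (case_prod X j -` {u j} \<inter> space P) = measure (distr P (count_space A) (X n m)) {u j}"
      using measure_distr[OF m(1) uA] nm by simp
    also have "\<dots> = P.prob (X n 0 -` {u j} \<inter> space P)"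
      unfolding id[OF nm(2,3)] by (rule measure_distr[OF m(2) uA])
    also have "X n 0 -` {u j} \<inter> space P = {x\<in>space P. X (fst j) 0 x = u j}" using nm by auto
    finally show ?thesis .
  qed
  show ?thesis
  proof (cases "?R = {}")
    \<comment> \<open>All rows are nonempty, so an empty rectangle means \<open>K = 0\<close>, and
      both sides are \<open>1\<close>. The product formula for independent variables is applied to
      nonempty index sets.\<close>
    case True
    have "{1..K} = {}"
    proof (rule ccontr)
      assume "{1..K} \<noteq> {}"
      then have "(1, 0) \<in> ?R" using d[of 1] by auto
      with True show False by blast
    qed
    then show ?thesis by (simp add: P.prob_space)
  next
    case False
    have "{x\<in>space P. \<forall>j\<in>?R. case_prod X j x = u j} = (\<Inter>j\<in>?R. case_prod X j -` {u j} \<inter> space P)"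
      using False by auto
    also have "P.prob \<dots> = (\<Prod>j\<in>?R. P.prob (case_prod X j -` {u j} \<inter> space P))"
      using False R_I u by (intro P.indep_varsD[OF ind]) auto
    also have "\<dots> = (\<Prod>j\<in>?R. P.prob {x\<in>space P. X (fst j) 0 x = u j})"
      by (intro prod.cong refl pt)
    also have "\<dots> = (\<Prod>n\<in>{1..K}. \<Prod>m<d n. P.prob {x\<in>space P. X n 0 x = u (n, m)})"
      by (subst prod.Sigma) (auto intro!: prod.cong simp: case_prod_beta)
    finally show ?thesis .
  qed
qed

theorem proposition1:
  fixes M :: "'x measure" and T :: "'x \<Rightarrow> 'x"
    and A :: "'a set" and d :: "nat \<Rightarrow> nat"
    and P :: "'w measure" and X :: "nat \<Rightarrow> nat \<Rightarrow> 'w \<Rightarrow> 'a"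
  assumes "standard_prob_space M"
    and "measure_preserving M T"
    and "invertible_on M T"
    and "ergodic M T"
    and "aperiodic M T"
    and "finite A"
    and "\<And>n. n \<ge> 1 \<Longrightarrow> d n > 0"
    and "triangular_array P A d X"
  shows "\<exists>f :: nat \<Rightarrow> 'x \<Rightarrow> 'a.
           (\<forall>n\<ge>1. f n \<in> measurable M (count_space A)) \<and>
           joint_distr M A d (\<lambda>n m. f n \<circ> (T ^^ m)) = joint_distr P A d X"
proof -
  note std = assms(1) and T = assms(2) and inv = assms(3) and A = assms(6) and d = assms(7) and arr = assms(8)
  interpret M: prob_space M using std by (simp add: standard_prob_space_def)
  interpret P: prob_space P using arr by (simp add: triangular_array_def)
  obtain U :: "'x \<Rightarrow> real" where U: "U \<in> borel_measurable M" "inj_on U (space M)"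
    using standard_prob_space_inj_real[OF std] by (elim bexE)
  define S where "S = the_inv_into (space M) T"
  have bij: "bij_betw T (space M) (space M)" using inv by (simp add: invertible_on_def)
  have ST: "S (T x) = x" "T (S x) = x" if "x \<in> space M" for x
    using bij that unfolding S_def by (auto simp: bij_betw_def the_inv_into_f_f f_the_inv_into_f)
  interpret sys: aperiodic_system M T S U
    by unfold_locales (use T inv assms(4,5) U ST in \<open>auto simp: measure_preserving_def invertible_on_def S_def\<close>)
  have X: "\<And>n m. (n, m) \<in> array_index d \<Longrightarrow> X n m \<in> measurable P (count_space A)"
    using arr by (auto simp: triangular_array_def)
  have X0: "X (Suc n) 0 \<in> measurable P (count_space A)" for n
    using d[of "Suc n"] by (intro X) (simp add: array_index_def)
  \<comment> \<open>Paintings use natural numbers as letters, so \<open>A\<close> is coded by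
    \<open>h\<close>.\<close>
  obtain h :: "'a \<Rightarrow> nat" where h: "bij_betw h A {0..<card A}"
    using ex_bij_betw_finite_nat[OF A] by blast
  have inj: "inj_on h A" and fin: "finite (h ` A)" using h A by (auto simp: bij_betw_def)
  \<comment> \<open>Rows are numbered from \<open>1\<close> in the array and from \<open>0\<close>
    in the construction, hence the shift by \<open>Suc\<close>. Place \<open>0\<close> carries the
    common law of its row.\<close>
  define p where "p n k = P.prob {x\<in>space P. h (X (Suc n) 0 x) = k}" for n k
  have XA: "X (Suc n) 0 x \<in> A" if "x \<in> space P" for n x
    using measurable_space[OF X0 that] by simp
  have p_pt: "p n (h b) = P.prob {x\<in>space P. X (Suc n) 0 x = b}" if "b \<in> A" for n b
    unfolding p_def using XA inj that by (intro arg_cong[of _ _ P.prob]) (auto dest: inj_onD)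
  have p_sum: "sum (p n) (h ` A) = 1" for n
  proof -
    have "sum (p n) (h ` A) = (\<Sum>b\<in>A. p n (h b))" by (simp add: sum.reindex[OF inj])
    also have "\<dots> = (\<Sum>b\<in>A. P.prob (X (Suc n) 0 -` {b} \<inter> space P))"
      using p_pt by (intro sum.cong refl) (auto intro!: arg_cong[of _ _ P.prob])
    also have "\<dots> = P.prob (\<Union>b\<in>A. X (Suc n) 0 -` {b} \<inter> space P)"
      using measurable_sets[OF X0] A
      by (intro P.finite_measure_finite_Union[symmetric]) (auto simp: disjoint_family_on_def)
    also have "(\<Union>b\<in>A. X (Suc n) 0 -` {b} \<inter> space P) = space P" using XA by auto
    finally show ?thesis by (simp add: P.prob_space)
  qed
  have p_out: "p n k = 0" if "k \<notin> h ` A" for n k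
  proof -
    have *: "{x\<in>space P. h (X (Suc n) 0 x) = k} = {}" using XA that by auto
    show ?thesis unfolding p_def * by simp
  qed
  have dS: "1 \<le> d (Suc n)" for n using d[of "Suc n"] by simp
  obtain g :: "nat \<Rightarrow> 'x \<Rightarrow> nat" where g: "\<forall>n. g n \<in> measurable M (count_space UNIV)"
    and gA: "\<forall>n. \<forall>x\<in>space M. g n x \<in> h ` A"
    and gind: "\<forall>K u. (\<forall>n. length (u n) = d (Suc n)) \<longrightarrow>
      M.prob {x\<in>space M. \<forall>n<K. sys.window (g n) (d (Suc n)) x = u n} = (\<Prod>n<K. prod_list (map (p n) (u n)))"
    using sys.exists_independent_processes[of "\<lambda>n. d (Suc n)" "h ` A" p, OF dS fin _ p_sum p_out]
    by (auto simp: p_def)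
  \<comment> \<open>Here \<open>n - 1\<close> undoes the shift. Row \<open>0\<close> repeats row
    \<open>1\<close> and lies outside \<open>array_index\<close>.\<close>
  define f where "f n x = the_inv_into A h (g (n - 1) x)" for n x
  have fA: "f n x \<in> A" and hf: "h (f n x) = g (n - 1) x" if "x \<in> space M" for n x
    using gA that the_inv_into_into[OF inj _ subset_refl] f_the_inv_into_f[OF inj] by (simp_all add: f_def)
  have f: "f n \<in> measurable M (count_space A)" for n
  proof -
    have "f n \<in> measurable M (count_space UNIV)"
      unfolding f_def[abs_def] by (rule measurable_compose[OF g[rule_format]]) simp
    then have "f n -` {b} \<inter> space M \<in> sets M" for b by (rule measurable_sets) simp
    then show ?thesis using fA by (simp add: measurable_count_space_eq2[OF A] Pi_iff)
  qed
  have "joint_distr M A d (\<lambda>n m. f n \<circ> (T ^^ m)) = joint_distr P A d X"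
  proof (rule joint_distr_eqI[OF M.prob_space_axioms P.prob_space_axioms A X])
    show "f n \<circ> (T ^^ m) \<in> measurable M (count_space A)" for n m
      using f by (intro measurable_comp[where N=M]) auto
  next
    fix K u
    let ?R = "Sigma {1..K} (\<lambda>n. {..<d n})"
    assume u: "u \<in> PiE ?R (\<lambda>_. A)"
    define v where "v n = map (\<lambda>m. h (u (Suc n, m))) [0..<d (Suc n)]" for n
    have "{x\<in>space M. \<forall>j\<in>?R. (case j of (n, m) \<Rightarrow> f n \<circ> (T ^^ m)) x = u j}
        = {x\<in>space M. \<forall>n<K. sys.window (g n) (d (Suc n)) x = v n}"
    proof (intro Collect_cong conj_cong refl)
      fix x assume x: "x \<in> space M"
      have hu: "f (Suc n) ((T ^^ m) x) = u (Suc n, m) \<longleftrightarrow> g n ((T ^^ m) x) = h (u (Suc n, m))"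
        if "n < K" "m < d (Suc n)" for n m
      proof -
        have "u (Suc n, m) \<in> A" using u that by auto
        then show ?thesis
          using inj_on_eq_iff[OF inj fA[of "(T ^^ m) x" "Suc n"]] hf[of "(T ^^ m) x" "Suc n"] x by simp
      qed
      have "(\<forall>j\<in>?R. (case j of (n, m) \<Rightarrow> f n \<circ> (T ^^ m)) x = u j)
        \<longleftrightarrow> (\<forall>n<K. \<forall>m<d (Suc n). f (Suc n) ((T ^^ m) x) = u (Suc n, m))"
      proof safe
        fix n m assume *: "\<forall>n<K. \<forall>m<d (Suc n). f (Suc n) ((T ^^ m) x) = u (Suc n, m)"
          and "n \<in> {1..K}" "m < d n"
        then show "(f n \<circ> (T ^^ m)) x = u (n, m)" by (cases n) auto
      qed auto
      also have "\<dots> \<longleftrightarrow> (\<forall>n<K. \<forall>m<d (Suc n). g n ((T ^^ m) x) = h (u (Suc n, m)))"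
        using hu by auto
      also have "\<dots> \<longleftrightarrow> (\<forall>n<K. sys.window (g n) (d (Suc n)) x = v n)"
        by (auto simp: sys.window_def v_def)
      finally show "(\<forall>j\<in>?R. (case j of (n, m) \<Rightarrow> f n \<circ> (T ^^ m)) x = u j)
        \<longleftrightarrow> (\<forall>n<K. sys.window (g n) (d (Suc n)) x = v n)" .
    qed
    then have "M.prob {x\<in>space M. \<forall>j\<in>?R. (case j of (n, m) \<Rightarrow> f n \<circ> (T ^^ m)) x = u j}
        = (\<Prod>n<K. prod_list (map (p n) (v n)))"
      using gind by (simp add: v_def)
    also have "\<dots> = (\<Prod>n<K. \<Prod>m<d (Suc n). P.prob {x\<in>space P. X (Suc n) 0 x = u (Suc n, m)})"
    proof (intro prod.cong refl)
      fix n assume n: "n \<in> {..<K}"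
      have "prod_list (map (p n) (v n)) = (\<Prod>m<d (Suc n). p n (h (u (Suc n, m))))"
        by (simp add: v_def comp_def prod.list_conv_set_nth lessThan_atLeast0)
      also have "\<dots> = (\<Prod>m<d (Suc n). P.prob {x\<in>space P. X (Suc n) 0 x = u (Suc n, m)})"
        using n u by (intro prod.cong refl p_pt) auto
      finally show "prod_list (map (p n) (v n)) = (\<Prod>m<d (Suc n). P.prob {x\<in>space P. X (Suc n) 0 x = u (Suc n, m)})" .
    qed
    also have "\<dots> = (\<Prod>n\<in>{1..K}. \<Prod>m<d n. P.prob {x\<in>space P. X n 0 x = u (n, m)})"
      by (rule prod.reindex_bij_witness[of _ "\<lambda>n. n - 1" Suc]) auto
    also have "\<dots> = P.prob {x\<in>space P. \<forall>j\<in>?R. case_prod X j x = u j}"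
      using triangular_array_prob_rectangle[OF arr d u] by simp
    finally show "M.prob {x\<in>space M. \<forall>j\<in>?R. (case j of (n, m) \<Rightarrow> f n \<circ> (T ^^ m)) x = u j}
        = P.prob {x\<in>space P. \<forall>j\<in>?R. case_prod X j x = u j}" .
  qed
  then show ?thesis using f by (intro exI[of _ f]) auto
qed

end
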